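(* Let $\mathfrak g=\mathfrak e_6$, let $V$ be its $27$-dimensional irreducible representation with highest weight $(0,0,0,0,0,1)$, and let $I=I_{(\mathfrak e_6,V)}$ be the associated invariant of oriented framed coloured $3$-tangles. Denote by $X_+,X_-,\mathrm{Id},\mathrm{H}$ the elementary oriented tangles described in the context, by $r$ the normalisation factor of $\mathrm H$, and put $q=e^{-\hat h^2/(72h)}$. Then the following skein relation holds in $\mathrm{End}_{\mathfrak e_6}(V\otimes V)\otimes_{\mathbf C}\mathbf C((\hat h))$: $$I(X_+)=\alpha\, I(X_-)+\beta\, I(\mathrm{Id})+\gamma\, I(\mathrm{H}),$$ where $$\alpha=q,\qquad \beta=\frac{q^3-1}{q},\qquad \gamma=-\frac{q^{27}+q^{15}-q^{12}-1}{r\,q^{13}}.$$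
   Context: An oriented framed coloured $3$-tangle is an oriented framed tangle in which trivalent branching points are allowed and whose edges are coloured by solid, dashed or dotted. The invariant $I_{(\mathfrak g,V)}=\Psi_{\mathfrak g}\circ\hat Z_f$ is the composite of the universal Vassiliev–Kontsevich invariant $\hat Z_f$ (extended to coloured $3$-tangles) with the $(\mathfrak g,V)$-weight system $\Psi_{\mathfrak g}$; it is a monoidal functor with values in $\mathfrak g$-linear maps between tensor products of representations, with coefficients in $\mathbf C[[\hat h]]$ ($\hat h$ a formal parameter). For $\mathfrak g=\mathfrak e_6$, solid strands are sent to $V$ or $V^*$ according to orientation, dashed strands to the adjoint representation $L$, dotted strands to $U$ or $U^*$ according to orientation. Decomposition: $V\otimes V\cong U\oplus V^*\oplus W$ with highest weights (Bourbaki/Humphreys numbering) $V:(0,0,0,0,0,1)$, $V^*:(1,0,0,0,0,0)$, $U:(0,0,0,0,0,2)$, $W:(0,0,0,0,1,0)$; the symmetric square is $U\oplus V^*$ and the exterior square is $W$. The summands are pairwise non-isomorphic; $\pi_Y$ denotes the projection of $V\otimes V$ onto the summand $Y$. Weight system normalisation: $h$ is a fixed non-zero complex number, the pairing on $L$ is $h\kappa$ with $\kappa$ the Killing form, and every trivalent vertex meeting a dashed edge carries a factor $\hat h$. Thus a dashed chord joining two parallel solid strands is sent to $\Theta=\frac{\hat h^2}{h}\,\Omega\in\mathrm{End}_{\mathfrak g}(V\otimes V)[[\hat h]]$, where $\Omega=\sum_a x_a\otimes x^a$ for dual bases $(x_a),(x^a)$ of $\mathfrak g$ with respect to $\kappa$.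 Values of $I$ on the elementary tangles with two incoming and two outgoing solid ends (all viewed as endomorphisms of $V\otimes V$): - $X_+$ (positive crossing) and $X_-$ (negative crossing), both strands oriented in parallel: $I(X_\pm)=\tau\circ e^{\mp\Theta/2}$, where $\tau(x\otimes y)=y\otimes x$. - $\mathrm{Id}$ (two parallel strands): $I(\mathrm{Id})=\mathrm{id}_{V\otimes V}$. - $\mathrm H$ (two solid ends merging at a trivalent vertex into a solid edge coloured $V^*$, which splits again into two solid ends): $I(\mathrm H)=r\,\pi_{V^*}$. The factor $r\in\mathbf C[[\hat h]]$ depends on the freely chosen non-zero normalisation constants of the trivalent vertices and is non-zero. *)

theory Defs
  imports
    "HOL-Analysis.Analysis"
    "HOL-Computational_Algebra.Formal_Laurent_Series"
begin

unbundle no fps_syntax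

section \<open>The Lie algebra of type \<open>E\<^sub>6\<close>\<close>

text \<open>
  A finite-dimensional complex Lie algebra is a bracket on the coordinate space
  \<^typ>\<open>complex^'m\<close>; scalar multiplication is \<open>(*s)\<close>.
\<close>

definition lie_algebra :: "(complex^'m \<Rightarrow> complex^'m \<Rightarrow> complex^'m) \<Rightarrow> bool" where
  "lie_algebra br \<longleftrightarrow>
     (\<forall>x. Vector_Spaces.linear (*s) (*s) (br x)) \<and>
     (\<forall>y. Vector_Spaces.linear (*s) (*s) (\<lambda>x. br x y)) \<and>
     (\<forall>x. br x x = 0) \<and>
     (\<forall>x y z. br x (br y z) + br y (br z x) + br z (br x y) = 0)"

definition simple_lie_algebra :: "(complex^'m \<Rightarrow> complex^'m \<Rightarrow> complex^'m) \<Rightarrow> bool" where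
  "simple_lie_algebra br \<longleftrightarrow>
     lie_algebra br \<and> (\<exists>x y. br x y \<noteq> 0) \<and>
     (\<forall>S. vec.subspace S \<and> (\<forall>x. \<forall>y\<in>S. br x y \<in> S) \<longrightarrow> S = {0} \<or> S = UNIV)"

definition lie_generated_by ::
    "(complex^'m \<Rightarrow> complex^'m \<Rightarrow> complex^'m) \<Rightarrow> (complex^'m) set \<Rightarrow> bool" where
  "lie_generated_by br G \<longleftrightarrow>
     (\<forall>S. vec.subspace S \<and> (\<forall>x\<in>S. \<forall>y\<in>S. br x y \<in> S) \<and> G \<subseteq> S \<longrightarrow> S = UNIV)"

text \<open>
  Bourbaki/Humphreys numbering of the Dynkin diagram: the chain 1 - 3 - 4 - 5 - 6,
  with 2 attached to 4.
\<close>

definition cartan_e6 :: "nat \<Rightarrow> nat \<Rightarrow> int" where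
  "cartan_e6 i j =
     (if i = j then 2
      else if {i, j} \<in> {{1, 3}, {3, 4}, {4, 5}, {5, 6}, {2, 4}} then - 1
      else 0)"

text \<open>
  \<open>E\<close>, \<open>F\<close>, \<open>H\<close> (indexed by \<open>1, \<dots>, 6\<close>) are Chevalley generators; by Serre's theorem these
  conditions determine the Lie algebra up to isomorphism.
\<close>

definition e6_chevalley ::
    "(complex^'m \<Rightarrow> complex^'m \<Rightarrow> complex^'m) \<Rightarrow>
     (nat \<Rightarrow> complex^'m) \<Rightarrow> (nat \<Rightarrow> complex^'m) \<Rightarrow> (nat \<Rightarrow> complex^'m) \<Rightarrow> bool" where
  "e6_chevalley br E F H \<longleftrightarrow>
     simple_lie_algebra br \<and>
     lie_generated_by br (E ` {1..6} \<union> F ` {1..6} \<union> H ` {1..6}) \<and>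
     (\<forall>i\<in>{1..6}. \<forall>j\<in>{1..6}.
        br (H i) (H j) = 0 \<and>
        br (H i) (E j) = of_int (cartan_e6 i j) *s E j \<and>
        br (H i) (F j) = - (of_int (cartan_e6 i j) *s F j) \<and>
        br (E i) (F j) = (if i = j then H i else 0) \<and>
        (i \<noteq> j \<longrightarrow>
           (br (E i) ^^ nat (1 - cartan_e6 i j)) (E j) = 0 \<and>
           (br (F i) ^^ nat (1 - cartan_e6 i j)) (F j) = 0))"

definition killing_form ::
    "(complex^'m \<Rightarrow> complex^'m \<Rightarrow> complex^'m) \<Rightarrow> complex^'m \<Rightarrow> complex^'m \<Rightarrow> complex" where
  "killing_form br x y = trace (matrix (br x) ** matrix (br y))"

definition dual_bases ::
    "(complex^'m \<Rightarrow> complex^'m \<Rightarrow> complex) \<Rightarrow>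
     ('m \<Rightarrow> complex^'m) \<Rightarrow> ('m \<Rightarrow> complex^'m) \<Rightarrow> bool" where
  "dual_bases B x y \<longleftrightarrow>
     inj x \<and> vec.independent (range x) \<and> vec.span (range x) = UNIV \<and>
     inj y \<and> vec.independent (range y) \<and> vec.span (range y) = UNIV \<and>
     (\<forall>a b. B (x a) (y b) = (if a = b then 1 else 0))"


section \<open>Representations\<close>

definition matrix_scale :: "'a::times \<Rightarrow> 'a^'n^'m \<Rightarrow> 'a^'n^'m"  (infixr \<open>*\<^sub>m\<close> 75) where
  "c *\<^sub>m A = map_matrix ((*) c) A"

definition lie_representation ::
    "(complex^'m \<Rightarrow> complex^'m \<Rightarrow> complex^'m) \<Rightarrow> (complex^'m \<Rightarrow> complex^'k^'k) \<Rightarrow> bool" where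
  "lie_representation br \<rho> \<longleftrightarrow>
     (\<forall>x y. \<rho> (x + y) = \<rho> x + \<rho> y) \<and>
     (\<forall>c x. \<rho> (c *s x) = c *\<^sub>m \<rho> x) \<and>
     (\<forall>x y. \<rho> (br x y) = \<rho> x ** \<rho> y - \<rho> y ** \<rho> x)"

definition subrepresentation :: "(complex^'m \<Rightarrow> complex^'k^'k) \<Rightarrow> (complex^'k) set \<Rightarrow> bool" where
  "subrepresentation \<rho> S \<longleftrightarrow> vec.subspace S \<and> (\<forall>x. \<forall>v\<in>S. \<rho> x *v v \<in> S)"

definition irreducible_subrep :: "(complex^'m \<Rightarrow> complex^'k^'k) \<Rightarrow> (complex^'k) set \<Rightarrow> bool" where
  "irreducible_subrep \<rho> S \<longleftrightarrow>
     subrepresentation \<rho> S \<and> S \<noteq> {0} \<and>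
     (\<forall>T. subrepresentation \<rho> T \<and> T \<subseteq> S \<longrightarrow> T = {0} \<or> T = S)"

text \<open>
  A weight is the list of its six coordinates with respect to the fundamental weights, i.e. of
  its values on the simple coroots \<open>H 1, \<dots>, H 6\<close>.
\<close>

definition has_highest_weight ::
    "(nat \<Rightarrow> complex^'m) \<Rightarrow> (nat \<Rightarrow> complex^'m) \<Rightarrow>
     (complex^'m \<Rightarrow> complex^'k^'k) \<Rightarrow> (complex^'k) set \<Rightarrow> nat list \<Rightarrow> bool" where
  "has_highest_weight E H \<rho> S wt \<longleftrightarrow>
     (\<exists>v\<in>S. v \<noteq> 0 \<and>
        (\<forall>i\<in>{1..6}. \<rho> (E i) *v v = 0 \<and> \<rho> (H i) *v v = of_nat (wt ! (i - 1)) *s v))"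

definition irrep_highest_weight ::
    "(nat \<Rightarrow> complex^'m) \<Rightarrow> (nat \<Rightarrow> complex^'m) \<Rightarrow>
     (complex^'m \<Rightarrow> complex^'k^'k) \<Rightarrow> (complex^'k) set \<Rightarrow> nat list \<Rightarrow> bool" where
  "irrep_highest_weight E H \<rho> S wt \<longleftrightarrow>
     irreducible_subrep \<rho> S \<and> has_highest_weight E H \<rho> S wt"


section \<open>The tensor square\<close>

text \<open>
  For \<open>V = \<complex>\<^sup>n\<close> with index type \<^typ>\<open>'n\<close>, the space \<open>V \<otimes> V\<close> is \<open>\<complex>\<^bsup>n\<times>n\<^esup>\<close>, where the pair
  \<open>(i, j)\<close> indexes the basis vector \<open>e\<^sub>i \<otimes> e\<^sub>j\<close>.
\<close>

definition kron :: "'a::times^'n^'n \<Rightarrow> 'a^'n^'n \<Rightarrow> 'a^('n \<times> 'n)^('n \<times> 'n)" where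
  "kron A B = (\<chi> p s. A $ fst p $ fst s * B $ snd p $ snd s)"

definition tensor_square ::
    "(complex^'m \<Rightarrow> complex^'n^'n) \<Rightarrow> complex^'m \<Rightarrow> complex^('n \<times> 'n)^('n \<times> 'n)" where
  "tensor_square \<rho> x = kron (\<rho> x) (mat 1) + kron (mat 1) (\<rho> x)"

definition flip_matrix :: "'a::zero_neq_one^('n::finite \<times> 'n)^('n \<times> 'n)" where
  "flip_matrix = (\<chi> p s. if p = prod.swap s then 1 else 0)"

definition omega_tensor ::
    "(complex^'m \<Rightarrow> complex^'n^'n) \<Rightarrow> ('m \<Rightarrow> complex^'m) \<Rightarrow> ('m \<Rightarrow> complex^'m) \<Rightarrow>
     complex^('n \<times> 'n)^('n \<times> 'n)" where
  "omega_tensor \<rho> x y = (\<Sum>a\<in>UNIV. kron (\<rho> (x a)) (\<rho> (y a)))"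

definition direct_sum3 ::
    "(complex^'k) set \<Rightarrow> (complex^'k) set \<Rightarrow> (complex^'k) set \<Rightarrow> bool" where
  "direct_sum3 U Y W \<longleftrightarrow> (\<forall>z. \<exists>!(u, y, w). u \<in> U \<and> y \<in> Y \<and> w \<in> W \<and> z = u + y + w)"

definition tensor_square_decomposition ::
    "(nat \<Rightarrow> complex^'m) \<Rightarrow> (nat \<Rightarrow> complex^'m) \<Rightarrow> (complex^'m \<Rightarrow> complex^'n^'n) \<Rightarrow>
     (complex^('n \<times> 'n)) set \<Rightarrow> (complex^('n \<times> 'n)) set \<Rightarrow> (complex^('n \<times> 'n)) set \<Rightarrow> bool" where
  "tensor_square_decomposition E H \<rho> U Vd W \<longleftrightarrow>
     direct_sum3 U Vd W \<and>
     irrep_highest_weight E H (tensor_square \<rho>) U [0, 0, 0, 0, 0, 2] \<and>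
     irrep_highest_weight E H (tensor_square \<rho>) Vd [1, 0, 0, 0, 0, 0] \<and>
     irrep_highest_weight E H (tensor_square \<rho>) W [0, 0, 0, 0, 1, 0]"

text \<open>The projection onto \<open>Y\<close> along a complementary subspace \<open>Z\<close>.\<close>

definition projection_onto :: "(complex^'k) set \<Rightarrow> (complex^'k) set \<Rightarrow> complex^'k^'k" where
  "projection_onto Y Z = matrix (\<lambda>v. THE y. y \<in> Y \<and> v - y \<in> Z)"


section \<open>The invariant on elementary tangles\<close>

text \<open>
  The formal parameter is \<^term>\<open>fps_X\<close>, and endomorphisms with coefficients in
  \<open>\<complex>[[X]]\<close> (in \<open>\<complex>((X))\<close>) are matrices over \<^typ>\<open>complex fps\<close> (over \<^typ>\<open>complex fls\<close>).

  The power \<open>A ^ k\<close> on the vector type is componentwise, hence the iterated matrix product.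
  If \<open>A\<close> has zero constant term, then \<open>A\<^sup>k\<close> is divisible by \<open>X\<^sup>k\<close>, so that only the terms
  with \<open>k \<le> d\<close> of the exponential series contribute to the coefficient of \<open>X\<^sup>d\<close>;
  \<open>fps_matrix_exp\<close> is meaningful only for such \<open>A\<close>.
\<close>

definition matrix_pow :: "'a::semiring_1^'k^'k \<Rightarrow> nat \<Rightarrow> 'a^'k^'k" where
  "matrix_pow A k = ((**) A ^^ k) (mat 1)"

definition fps_matrix_exp :: "complex fps^'k^'k \<Rightarrow> complex fps^'k^'k" where
  "fps_matrix_exp A =
     (\<chi> i j. Abs_fps (\<lambda>d. \<Sum>k\<le>d. fps_nth (matrix_pow A k $ i $ j) d / fact k))"

text \<open>
  The image of a dashed chord joining two parallel solid strands: the pairing \<open>h \<kappa>\<close> on the adjoint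
  representation yields \<open>\<Omega> / h\<close>, and each of the two trivalent vertices a factor \<open>X\<close>.
\<close>

definition theta_chord :: "complex \<Rightarrow> complex^'k^'k \<Rightarrow> complex fps^'k^'k" where
  "theta_chord h \<Omega> = (fps_const (1 / h) * fps_X\<^sup>2) *\<^sub>m map_matrix fps_const \<Omega>"

datatype elementary_tangle = X_pos | X_neg | Id_strands | H_tangle

text \<open>
  \<open>\<Omega>\<close> is the Casimir tensor, \<open>P\<close> the projection onto the summand \<open>V\<^sup>*\<close> and \<open>r\<close> the
  normalisation factor coming from the trivalent vertices.
\<close>

fun invariant_fps ::
    "complex \<Rightarrow> complex^('n::finite \<times> 'n)^('n \<times> 'n) \<Rightarrow> complex^('n \<times> 'n)^('n \<times> 'n) \<Rightarrow> complex fps \<Rightarrow>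
     elementary_tangle \<Rightarrow> complex fps^('n \<times> 'n)^('n \<times> 'n)" where
  "invariant_fps h \<Omega> P r X_pos =
     flip_matrix ** fps_matrix_exp (fps_const (- 1 / 2) *\<^sub>m theta_chord h \<Omega>)"
| "invariant_fps h \<Omega> P r X_neg =
     flip_matrix ** fps_matrix_exp (fps_const (1 / 2) *\<^sub>m theta_chord h \<Omega>)"
| "invariant_fps h \<Omega> P r Id_strands = mat 1"
| "invariant_fps h \<Omega> P r H_tangle = r *\<^sub>m map_matrix fps_const P"

definition invariant ::
    "complex \<Rightarrow> complex^('n::finite \<times> 'n)^('n \<times> 'n) \<Rightarrow> complex^('n \<times> 'n)^('n \<times> 'n) \<Rightarrow> complex fps \<Rightarrow>
     elementary_tangle \<Rightarrow> complex fls^('n \<times> 'n)^('n \<times> 'n)" where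
  "invariant h \<Omega> P r T = map_matrix fps_to_fls (invariant_fps h \<Omega> P r T)"

definition q_param :: "complex \<Rightarrow> complex fls" where
  "q_param h = fps_to_fls (fps_compose (fps_exp (- 1 / (72 * h))) (fps_X\<^sup>2))"

end

theory Submission
  imports Defs
begin

text \<open>
  By the triangular decomposition, the Casimir operator acts on an irreducible representation of
  highest weight \<open>\<mu>\<close> by \<open>(\<mu>, \<mu> + 2\<delta>) / k\<close>, where \<open>\<delta>\<close> is the half sum of the positive roots and
  \<open>k = \<kappa>(E\<^sub>i, F\<^sub>i)\<close>. This gives the eigenvalues of \<open>\<Omega>\<close> on the three summands up to the factor \<open>1/k\<close>.
  The flip commutes with \<open>\<Omega>\<close>, so it acts on each summand by a sign. The traces of \<open>1\<close>, \<open>\<tau>\<close>, \<open>\<Omega>\<close> and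
  \<open>\<tau>\<Omega>\<close> determine these signs and the dimensions. Finally the trace of \<open>\<tau>\<Omega>\<^sup>2\<close>, computed with the help
  of the fact that the Casimir operator of the adjoint representation is the identity, yields
  \<open>k = 24\<close>; no list of the roots is needed. The skein relation is then checked on each summand.
\<close>

section \<open>Matrices\<close>

text \<open>The obstacle is the normalisation k: every Casimir eigenvalue obtained from a highest
  weight is proportional to 1/k, and k itself is a trace over the adjoint representation, whose
  weights are not enumerated. The traces of 1, \<tau>, \<Omega> and \<tau>\<Omega> cannot detect k,
  since multiplying the last two by k removes it. The trace of \<tau>\<Omega>^2 mixes two scalings:
  it equals 27 c (c - 1/2), where c, the Casimir eigenvalue of V, is proportional to 1/k, while 1/2
  is absolute, being half the Casimir eigenvalue 1 of the adjoint representation. The half sum of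
  positive roots is also obtained without roots: 2\<delta> arises as the sum of the brackets
  [x_a, (y_a)_-], with (y_a)_- the component in the negative half. It is identified by its brackets
  with the generators, because the centre is zero. The number 72 in q is 3k: the eigenvalues of
  \<Omega> are 4, -26 and -2 over 3k, and the factor 1/2 in the exponent of a crossing leaves the
  powers 2, -13 and -1 of q.\<close>

lemma matrix_scale_nth [simp]: "(c *\<^sub>m A) $ i $ j = c * A $ i $ j"
  by (simp add: matrix_scale_def)

lemma matrix_sub_ldistrib: "(A::'a::ring_1^'n^'m) ** (B - C) = A ** B - A ** C"
  by (simp add: matrix_matrix_mult_def vec_eq_iff right_diff_distrib sum_subtractf)

lemma matrix_sub_rdistrib: "((A::'a::ring_1^'n^'m) - B) ** C = A ** C - B ** C"
  by (simp add: matrix_matrix_mult_def vec_eq_iff left_diff_distrib sum_subtractf)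

lemma matrix_add_rdistrib': "((A::'a::semiring_1^'n^'m) + B) ** C = A ** C + B ** C"
  by (simp add: matrix_matrix_mult_def vec_eq_iff distrib_right sum.distrib)

lemma matrix_sum_ldistrib: "(A::'a::semiring_1^'n^'m) ** (\<Sum>i\<in>I. f i) = (\<Sum>i\<in>I. A ** f i)"
  by (induction I rule: infinite_finite_induct) (simp_all add: matrix_add_ldistrib)

lemma matrix_sum_rdistrib: "(\<Sum>i\<in>I. f i) ** (A::'a::semiring_1^'n^'m) = (\<Sum>i\<in>I. f i ** A)"
  by (induction I rule: infinite_finite_induct) (simp_all add: matrix_add_rdistrib')

lemma matrix_scale_mult_left [simp]: "(c *\<^sub>m A) ** B = c *\<^sub>m ((A::'a::comm_semiring_1^'n^'m) ** B)"
  by (simp add: matrix_matrix_mult_def vec_eq_iff sum_distrib_left mult.assoc)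

lemma matrix_scale_mult_right [simp]: "A ** (c *\<^sub>m B) = c *\<^sub>m ((A::'a::comm_semiring_1^'n^'m) ** B)"
  by (simp add: matrix_matrix_mult_def vec_eq_iff sum_distrib_left mult_ac)

lemma matrix_scale_vector [simp]: "(c *\<^sub>m A) *v v = c *s ((A::'a::comm_semiring_1^'n^'m) *v v)"
  by (simp add: matrix_vector_mult_def vec_eq_iff sum_distrib_left mult_ac)

lemma matrix_scale_simps [simp]:
  fixes A B :: "'a::comm_ring_1^'n^'m"
  shows "c *\<^sub>m (A + B) = c *\<^sub>m A + c *\<^sub>m B" "c *\<^sub>m (A - B) = c *\<^sub>m A - c *\<^sub>m B"
    "c *\<^sub>m d *\<^sub>m A = (c * d) *\<^sub>m A" "0 *\<^sub>m A = 0" "1 *\<^sub>m A = A" "c *\<^sub>m 0 = (0::'a^'n^'m)"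
    "c *\<^sub>m (- A) = - (c *\<^sub>m A)" "(- c) *\<^sub>m A = - (c *\<^sub>m A)"
  by (simp_all add: vec_eq_iff algebra_simps)

lemma matrix_sum_vector: "(\<Sum>i\<in>I. f i) *v v = (\<Sum>i\<in>I. f i *v (v :: 'a::comm_ring_1^'n))"
  by (induction I rule: infinite_finite_induct) (simp_all add: matrix_vector_mult_add_rdistrib)

lemma trace_scale [simp]: "trace (c *\<^sub>m A) = c * trace (A :: 'a::comm_ring_1^'n^'n)"
  by (simp add: trace_def sum_distrib_left)

lemma trace_zero [simp]: "trace (0 :: 'a::comm_ring_1^'n^'n) = 0"
  by (simp add: trace_def)

lemma trace_sum: "trace (\<Sum>i\<in>I. f i) = (\<Sum>i\<in>I. trace (f i :: 'a::comm_ring_1^'n^'n))"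
  by (induction I rule: infinite_finite_induct) (simp_all add: trace_add)


section \<open>The Killing form and dual bases\<close>

text \<open>Scalars may move between the arguments but need not come out of \<open>f\<close>. The
  target can therefore be any abelian group, for instance matrices, whose scaling is
  \<open>*\<^sub>m\<close>.\<close>

definition balanced_bilinear :: "(complex^'m \<Rightarrow> complex^'m \<Rightarrow> 'b::ab_group_add) \<Rightarrow> bool" where
  "balanced_bilinear f \<longleftrightarrow>
     (\<forall>x y z. f (x + y) z = f x z + f y z) \<and> (\<forall>x y z. f x (y + z) = f x y + f x z) \<and>
     (\<forall>c x y. f (c *s x) y = f x (c *s y))"

lemma balanced_bilinear_sum:
  assumes "balanced_bilinear f"
  shows "f (\<Sum>i\<in>I. g i) z = (\<Sum>i\<in>I. f (g i) z)" "f z (\<Sum>i\<in>I. g i) = (\<Sum>i\<in>I. f z (g i))"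
proof -
  have "f 0 z = 0" "f z 0 = 0" for z
    using assms unfolding balanced_bilinear_def by (metis add_0 add_cancel_right_left)+
  then show "f (\<Sum>i\<in>I. g i) z = (\<Sum>i\<in>I. f (g i) z)" "f z (\<Sum>i\<in>I. g i) = (\<Sum>i\<in>I. f z (g i))"
    using assms unfolding balanced_bilinear_def
    by (induction I rule: infinite_finite_induct) simp_all
qed

locale complex_lie_algebra =
  fixes br :: "complex^'m \<Rightarrow> complex^'m \<Rightarrow> complex^'m"
  assumes lie: "lie_algebra br"
begin

abbreviation "\<kappa> \<equiv> killing_form br"

lemma linear_br: "Vector_Spaces.linear (*s) (*s) (br x)"
  and linear_br': "Vector_Spaces.linear (*s) (*s) (\<lambda>x. br x y)"
  using lie by (auto simp: lie_algebra_def)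

lemma br_simps [simp]:
  "br x (y + z) = br x y + br x z" "br (x + y) z = br x z + br y z"
  "br x (y - z) = br x y - br x z" "br (x - y) z = br x z - br y z"
  "br x (c *s y) = c *s br x y" "br (c *s x) y = c *s br x y"
  "br x 0 = 0" "br 0 x = 0" "br x (- y) = - br x y" "br (- x) y = - br x y" "br x x = 0"
  using lie vec.linear_add[OF linear_br] vec.linear_add[OF linear_br'] vec.linear_diff[OF linear_br]
    vec.linear_diff[OF linear_br'] vec.linear_scale[OF linear_br] vec.linear_scale[OF linear_br']
    vec.linear_0[OF linear_br] vec.linear_0[OF linear_br'] vec.linear_neg[OF linear_br]
    vec.linear_neg[OF linear_br']
  by (simp_all add: lie_algebra_def)

lemma br_sum: "br x (\<Sum>i\<in>I. f i) = (\<Sum>i\<in>I. br x (f i))" "br (\<Sum>i\<in>I. f i) x = (\<Sum>i\<in>I. br (f i) x)"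
  by (induction I rule: infinite_finite_induct) simp_all

lemma br_anti: "br y x = - br x y"
proof -
  have "br (x + y) (x + y) = 0" by (rule br_simps(11))
  then show ?thesis by (simp del: br_simps(11) add: br_simps(11)[of x] br_simps(11)[of y] eq_neg_iff_add_eq_0)
qed

lemma br_jacobi: "br x (br y z) = br (br x y) z + br y (br x z)"
proof -
  have "br x (br y z) + br y (br z x) + br z (br x y) = 0" using lie by (auto simp: lie_algebra_def)
  moreover have "br z x = - br x z" "br z (br x y) = - br (br x y) z" by (rule br_anti)+
  ultimately show ?thesis by (simp add: algebra_simps)
qed

lemma ad_mult: "matrix (br x) ** matrix (br y) = matrix (\<lambda>z. br x (br y z))"
  using matrix_compose_gen[OF linear_br linear_br, of x y] by (simp add: o_def)

lemma killing_sym: "\<kappa> x y = \<kappa> y x"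
  unfolding killing_form_def by (rule trace_mul_sym)

lemma killing_simps [simp]:
  "\<kappa> (x + y) z = \<kappa> x z + \<kappa> y z" "\<kappa> z (x + y) = \<kappa> z x + \<kappa> z y"
  "\<kappa> (c *s x) z = c * \<kappa> x z" "\<kappa> z (c *s x) = c * \<kappa> z x"
  "\<kappa> (x - y) z = \<kappa> x z - \<kappa> y z" "\<kappa> z (x - y) = \<kappa> z x - \<kappa> z y"
  "\<kappa> (- x) z = - \<kappa> x z" "\<kappa> z (- x) = - \<kappa> z x" "\<kappa> 0 z = 0" "\<kappa> z 0 = 0"
  by (simp_all add: killing_form_def trace_def matrix_def matrix_matrix_mult_def sum.distrib
      sum_subtractf sum_negf algebra_simps sum_distrib_left)

lemma killing_sum: "\<kappa> (\<Sum>i\<in>I. f i) z = (\<Sum>i\<in>I. \<kappa> (f i) z)" "\<kappa> z (\<Sum>i\<in>I. f i) = (\<Sum>i\<in>I. \<kappa> z (f i))"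
  by (induction I rule: infinite_finite_induct) simp_all

lemma killing_br: "\<kappa> (br x y) z = \<kappa> x (br y z)"
proof -
  have ad: "matrix (br (br x y)) = matrix (br x) ** matrix (br y) - matrix (br y) ** matrix (br x)" for x y
    unfolding ad_mult by (simp add: matrix_def vec_eq_iff br_jacobi[of x y])
  have "\<kappa> (br x y) z = trace (matrix (br x) ** matrix (br y) ** matrix (br z))
      - trace (matrix (br y) ** matrix (br x) ** matrix (br z))"
    by (simp add: killing_form_def ad matrix_sub_rdistrib trace_sub)
  also have "trace (matrix (br y) ** matrix (br x) ** matrix (br z))
      = trace (matrix (br x) ** (matrix (br z) ** matrix (br y)))"
    by (metis matrix_mul_assoc trace_mul_sym)
  also have "trace (matrix (br x) ** matrix (br y) ** matrix (br z)) -
      trace (matrix (br x) ** (matrix (br z) ** matrix (br y))) = \<kappa> x (br y z)"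
    by (simp add: killing_form_def ad matrix_sub_ldistrib trace_sub matrix_mul_assoc)
  finally show ?thesis .
qed

lemma killing_br': "\<kappa> (br x y) z = - \<kappa> y (br x z)"
  by (metis br_anti killing_br killing_simps(7))

end

locale killing_dual = complex_lie_algebra br for br :: "complex^'m \<Rightarrow> complex^'m \<Rightarrow> complex^'m" +
  fixes x y :: "'m \<Rightarrow> complex^'m"
  assumes dual: "dual_bases (killing_form br) x y"
begin

lemma killing_xy: "\<kappa> (x a) (y b) = (if a = b then 1 else 0)"
  using dual by (simp add: dual_bases_def)

lemma expand_x: "z = (\<Sum>a\<in>UNIV. \<kappa> z (y a) *s x a)"
proof -
  have "z \<in> vec.span (range x)" using dual by (simp add: dual_bases_def)
  then obtain c where "z = (\<Sum>v\<in>range x. c v *s v)"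
    by (auto simp: vec.span_finite)
  moreover have "inj x" using dual by (simp add: dual_bases_def)
  ultimately have z: "z = (\<Sum>a\<in>UNIV. c (x a) *s x a)" by (simp add: sum.reindex)
  have "\<kappa> z (y b) = c (x b)" for b
    by (subst z) (simp add: killing_sum killing_xy if_distrib cong: if_cong)
  then show ?thesis using z by simp
qed

lemma expand_y: "z = (\<Sum>a\<in>UNIV. \<kappa> (x a) z *s y a)"
proof -
  have "z \<in> vec.span (range y)" using dual by (simp add: dual_bases_def)
  then obtain c where "z = (\<Sum>v\<in>range y. c v *s v)"
    by (auto simp: vec.span_finite)
  moreover have "inj y" using dual by (simp add: dual_bases_def)
  ultimately have z: "z = (\<Sum>a\<in>UNIV. c (y a) *s y a)" by (simp add: sum.reindex)
  have "\<kappa> (x b) z = c (y b)" for b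
    by (subst z) (simp add: killing_sum killing_xy if_distrib cong: if_cong)
  then show ?thesis using z by simp
qed

lemma killing_nondegenerate: "(\<And>w. \<kappa> z w = 0) \<Longrightarrow> z = 0"
  using expand_x[of z] by simp

lemma killing_eqI: "(\<And>w. \<kappa> z w = \<kappa> z' w) \<Longrightarrow> z = z'"
  using killing_nondegenerate[of "z - z'"] by simp

text \<open>Under \<kappa> the tensor formed from dual bases corresponds to the identity map, so an
  operator on its first factor can be traded for the \<kappa>-adjoint operator on the
  second.\<close>

lemma sum_dual_adjoint:
  assumes f: "balanced_bilinear f" and A: "\<And>z w. \<kappa> (A z) w = \<kappa> z (A' w)"
  shows "(\<Sum>a\<in>UNIV. f (A (x a)) (y a)) = (\<Sum>a\<in>UNIV. f (x a) (A' (y a)))"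
proof -
  have "(\<Sum>a\<in>UNIV. f (A (x a)) (y a)) = (\<Sum>a\<in>UNIV. f (\<Sum>b\<in>UNIV. \<kappa> (x a) (A' (y b)) *s x b) (y a))"
    by (subst expand_x[of "A _"]) (simp add: A)
  also have "\<dots> = (\<Sum>a\<in>UNIV. \<Sum>b\<in>UNIV. f (x b) (\<kappa> (x a) (A' (y b)) *s y a))"
    using f by (simp add: balanced_bilinear_sum balanced_bilinear_def)
  also have "\<dots> = (\<Sum>b\<in>UNIV. f (x b) (\<Sum>a\<in>UNIV. \<kappa> (x a) (A' (y b)) *s y a))"
    by (subst sum.swap) (simp add: balanced_bilinear_sum[OF f])
  finally show ?thesis by (simp flip: expand_y)
qed

lemma sum_dual_swap:
  assumes f: "balanced_bilinear f"
  shows "(\<Sum>a\<in>UNIV. f (x a) (y a)) = (\<Sum>a\<in>UNIV. f (y a) (x a))"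
proof -
  have "(\<Sum>a\<in>UNIV. f (x a) (y a)) = (\<Sum>a\<in>UNIV. f (\<Sum>b\<in>UNIV. \<kappa> (x b) (x a) *s y b) (y a))"
    by (simp flip: expand_y)
  also have "\<dots> = (\<Sum>a\<in>UNIV. \<Sum>b\<in>UNIV. f (y b) (\<kappa> (x b) (x a) *s y a))"
    using f by (simp add: balanced_bilinear_sum balanced_bilinear_def)
  also have "\<dots> = (\<Sum>b\<in>UNIV. f (y b) (\<Sum>a\<in>UNIV. \<kappa> (x a) (x b) *s y a))"
    by (subst sum.swap) (simp add: balanced_bilinear_sum[OF f] killing_sym)
  finally show ?thesis by (simp flip: expand_y)
qed

text \<open>Invariance of the Casimir tensor: \<open>br z\<close> is skew-adjoint for
  \<kappa>.\<close>

lemma sum_dual_ad: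
  assumes f: "balanced_bilinear f"
  shows "(\<Sum>a\<in>UNIV. f (br z (x a)) (y a)) + (\<Sum>a\<in>UNIV. f (x a) (br z (y a))) = 0"
proof -
  have "(\<Sum>a\<in>UNIV. f (br z (x a)) (y a)) = (\<Sum>a\<in>UNIV. f (x a) (- br z (y a)))"
    by (rule sum_dual_adjoint[OF f]) (metis killing_br' killing_br br_anti killing_simps(8))
  also have "\<dots> = - (\<Sum>a\<in>UNIV. f (x a) (br z (y a)))"
  proof -
    have "f u 0 = 0" for u using balanced_bilinear_sum(2)[OF f, of u "\<lambda>_. 0" "{}"] by simp
    then have "f u v + f u (- v) = 0" for u v
      using f unfolding balanced_bilinear_def by (metis add.right_inverse)
    then have "f u (- v) = - f u v" for u v by (simp add: eq_neg_iff_add_eq_0 add.commute)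
    then show ?thesis by (simp add: sum_negf)
  qed
  finally show ?thesis by simp
qed

text \<open>\<open>\<kappa> (x a)\<close> is the coordinate functional of \<open>y a\<close>, so the
  right side is the trace computed in the basis \<open>y\<close>.\<close>

lemma trace_eq_sum_dual:
  assumes M: "Vector_Spaces.linear (*s) (*s) M"
  shows "trace (matrix M) = (\<Sum>a\<in>UNIV. \<kappa> (x a) (M (y a)))"
proof -
  have "M (y a) = (\<Sum>i\<in>UNIV. y a $ i *s M (axis i 1))" for a
  proof -
    interpret Vector_Spaces.linear "(*s)" "(*s)" M by (fact M)
    have "M (y a) = M (\<Sum>i\<in>UNIV. y a $ i *s axis i 1)" by (simp add: basis_expansion)
    then show ?thesis by (simp add: sum scale)
  qed
  then have "(\<Sum>a\<in>UNIV. \<kappa> (x a) (M (y a))) = (\<Sum>a\<in>UNIV. \<Sum>i\<in>UNIV. y a $ i * \<kappa> (x a) (M (axis i 1)))"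
    by (simp add: killing_sum)
  also have "\<dots> = (\<Sum>i\<in>UNIV. (\<Sum>a\<in>UNIV. \<kappa> (x a) (M (axis i 1)) *s y a) $ i)"
    by (subst sum.swap) (simp add: mult.commute)
  also have "\<dots> = trace (matrix M)" by (simp add: trace_def matrix_def flip: expand_y)
  finally show ?thesis ..
qed

text \<open>After pairing with w, invariance turns the sum into the trace of ad z ad w in dual
  bases, which is \<kappa> z w by definition. The eigenvalue 1 thus reflects that the dual bases
  belong to the Killing form itself.\<close>

lemma casimir_adjoint: "(\<Sum>a\<in>UNIV. br (x a) (br (y a) z)) = z"
proof (rule killing_eqI)
  fix w
  have "\<kappa> (\<Sum>a\<in>UNIV. br (x a) (br (y a) z)) w = (\<Sum>a\<in>UNIV. - \<kappa> (br w (x a)) (br z (y a)))"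
    unfolding killing_sum
  proof (rule sum.cong[OF refl])
    fix a
    have "\<kappa> (br (x a) (br (y a) z)) w = - \<kappa> (br (y a) z) (br (x a) w)" by (rule killing_br')
    also have "\<dots> = - \<kappa> (br w (x a)) (br z (y a))"
      by (simp add: br_anti[of z "y a"] br_anti[of w "x a"] killing_sym)
    finally show "\<kappa> (br (x a) (br (y a) z)) w = - \<kappa> (br w (x a)) (br z (y a))" .
  qed
  also have "\<dots> = (\<Sum>a\<in>UNIV. - \<kappa> (br w (y a)) (br z (x a)))"
    by (rule sum_dual_swap) (simp add: balanced_bilinear_def)
  also have "\<dots> = (\<Sum>a\<in>UNIV. \<kappa> (x a) (br z (br w (y a))))"
  proof (rule sum.cong[OF refl])
    fix a
    have "- \<kappa> (br w (y a)) (br z (x a)) = - \<kappa> (br z (x a)) (br w (y a))" by (simp add: killing_sym)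
    also have "\<dots> = \<kappa> (x a) (br z (br w (y a)))" by (subst killing_br') simp
    finally show "- \<kappa> (br w (y a)) (br z (x a)) = \<kappa> (x a) (br z (br w (y a)))" .
  qed
  also have "\<dots> = trace (matrix (\<lambda>v. br z (br w v)))"
    by (rule trace_eq_sum_dual[symmetric])
      (use linear_br[of z] linear_br[of w] Vector_Spaces.linear_compose in \<open>fastforce simp: o_def\<close>)
  also have "\<dots> = \<kappa> z w" by (simp add: killing_form_def ad_mult)
  finally show "\<kappa> (\<Sum>a\<in>UNIV. br (x a) (br (y a) z)) w = \<kappa> z w" .
qed

end

section \<open>The triangular decomposition\<close>

declare One_nat_def [simp del]

lemma cartan_e6_simps:
  "cartan_e6 i i = 2"
  "cartan_e6 1 2 = 0" "cartan_e6 1 3 = -1" "cartan_e6 1 4 = 0" "cartan_e6 1 5 = 0" "cartan_e6 1 6 = 0"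
  "cartan_e6 2 1 = 0" "cartan_e6 2 3 = 0" "cartan_e6 2 4 = -1" "cartan_e6 2 5 = 0" "cartan_e6 2 6 = 0"
  "cartan_e6 3 1 = -1" "cartan_e6 3 2 = 0" "cartan_e6 3 4 = -1" "cartan_e6 3 5 = 0" "cartan_e6 3 6 = 0"
  "cartan_e6 4 1 = 0" "cartan_e6 4 2 = -1" "cartan_e6 4 3 = -1" "cartan_e6 4 5 = -1" "cartan_e6 4 6 = 0"
  "cartan_e6 5 1 = 0" "cartan_e6 5 2 = 0" "cartan_e6 5 3 = 0" "cartan_e6 5 4 = -1" "cartan_e6 5 6 = -1"
  "cartan_e6 6 1 = 0" "cartan_e6 6 2 = 0" "cartan_e6 6 3 = 0" "cartan_e6 6 4 = 0" "cartan_e6 6 5 = -1"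
  by (simp_all add: cartan_e6_def doubleton_eq_iff)

lemma cartan_e6_sym: "cartan_e6 i j = cartan_e6 j i"
  by (simp add: cartan_e6_def insert_commute)

lemma interval_1_6: "{1..6} = {1, 2, 3, 4, 5, 6::nat}"
  by auto

text \<open>
  The coefficients are the row sums of the inverse Cartan matrix, so that every simple root takes
  the value 1 on this element.
\<close>

definition height_element :: "(nat \<Rightarrow> complex^'m) \<Rightarrow> complex^'m" where
  "height_element H = 8 *s H 1 + 11 *s H 2 + 15 *s H 3 + 21 *s H 4 + 15 *s H 5 + 8 *s H 6"

text \<open>Right-nested monomials in the generators stand in for root vectors. Below, their span is
  only ever bracketed with single generators.\<close>

inductive_set iterated_brackets ::
    "(complex^'m \<Rightarrow> complex^'m \<Rightarrow> complex^'m) \<Rightarrow> (nat \<Rightarrow> complex^'m) \<Rightarrow> (complex^'m) set"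
  for br G where
  base: "i \<in> {1..6} \<Longrightarrow> G i \<in> iterated_brackets br G"
| step: "z \<in> iterated_brackets br G \<Longrightarrow> i \<in> {1..6} \<Longrightarrow> br (G i) z \<in> iterated_brackets br G"

text \<open>The relations are invariant under \<open>(E, F, H) \<mapsto> (F, E, - H)\<close>.\<close>

locale e6_relations = complex_lie_algebra br
  for br :: "complex^'m \<Rightarrow> complex^'m \<Rightarrow> complex^'m" +
  fixes E F H :: "nat \<Rightarrow> complex^'m"
  assumes br_HH: "i \<in> {1..6} \<Longrightarrow> j \<in> {1..6} \<Longrightarrow> br (H i) (H j) = 0"
    and br_HE: "i \<in> {1..6} \<Longrightarrow> j \<in> {1..6} \<Longrightarrow> br (H i) (E j) = of_int (cartan_e6 i j) *s E j"
    and br_HF: "i \<in> {1..6} \<Longrightarrow> j \<in> {1..6} \<Longrightarrow> br (H i) (F j) = - (of_int (cartan_e6 i j) *s F j)"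
    and br_EF: "i \<in> {1..6} \<Longrightarrow> j \<in> {1..6} \<Longrightarrow> br (E i) (F j) = (if i = j then H i else 0)"
begin

text \<open>This is n_+ in the interpretation \<open>pos\<close> below and n_- in
  \<open>neg\<close>.\<close>

definition "nil_part = vec.span (iterated_brackets br E)"
definition "cartan_part = vec.span (H ` {1..6})"

lemma subspace_nil_part: "vec.subspace nil_part"
  by (simp add: nil_part_def)

lemma E_in_nil_part: "i \<in> {1..6} \<Longrightarrow> E i \<in> nil_part"
  by (simp add: nil_part_def vec.span_base iterated_brackets.base)

lemma br_height_E: "i \<in> {1..6} \<Longrightarrow> br (height_element H) (E i) = E i"
  unfolding height_element_def
  by (auto simp: interval_1_6 br_HE cartan_e6_simps vec_eq_iff)

lemma br_height_H: "i \<in> {1..6} \<Longrightarrow> br (height_element H) (H i) = 0"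
  unfolding height_element_def by (auto simp: interval_1_6 br_HH)

text \<open>Bracketing with the height element is a derivation, so degrees add. This grading by
  positive integers replaces the root space decomposition.\<close>

lemma iterated_brackets_degree:
  "z \<in> iterated_brackets br E \<Longrightarrow> \<exists>n::nat. n > 0 \<and> br (height_element H) z = of_nat n *s z"
proof (induction rule: iterated_brackets.induct)
  case (base i)
  then show ?case using br_height_E by (intro exI[of _ 1]) auto
next
  case (step z i)
  then obtain n :: nat where n: "br (height_element H) z = of_nat n *s z" by auto
  have "br (height_element H) (br (E i) z) = of_nat (Suc n) *s br (E i) z"
    by (subst br_jacobi) (simp add: n br_height_E[OF step(2)] vec_eq_iff algebra_simps)
  then show ?case by blast
qed

lemma iterated_brackets_weight:
  "z \<in> iterated_brackets br E \<Longrightarrow> i \<in> {1..6} \<Longrightarrow> \<exists>c. br (H i) z = c *s z"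
proof (induction rule: iterated_brackets.induct)
  case (base j)
  then show ?case using br_HE by blast
next
  case (step z j)
  then obtain c where c: "br (H i) z = c *s z" by auto
  have "br (H i) (br (E j) z) = (of_int (cartan_e6 i j) + c) *s br (E j) z"
    by (subst br_jacobi) (simp add: c br_HE[OF step(4) step(2)] vec_eq_iff algebra_simps)
  then show ?case by blast
qed

lemma br_E_nil_part: "z \<in> nil_part \<Longrightarrow> i \<in> {1..6} \<Longrightarrow> br (E i) z \<in> nil_part"
  unfolding nil_part_def
proof (induction rule: vec.span_induct_alt)
  case (step c z w)
  then have "br (E i) z \<in> vec.span (iterated_brackets br E)"
    by (blast intro: vec.span_base iterated_brackets.step)
  then show ?case using step by (auto intro!: vec.span_add vec.span_scale)
qed (simp add: vec.span_zero)

lemma br_H_nil_part: "z \<in> nil_part \<Longrightarrow> i \<in> {1..6} \<Longrightarrow> br (H i) z \<in> nil_part"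
  unfolding nil_part_def
proof (induction rule: vec.span_induct_alt)
  case (step c z w)
  obtain d where "br (H i) z = d *s z" using iterated_brackets_weight step by blast
  then show ?case using step by (auto intro!: vec.span_add vec.span_scale intro: vec.span_base)
qed (simp add: vec.span_zero)

lemma br_E_H: "i \<in> {1..6} \<Longrightarrow> j \<in> {1..6} \<Longrightarrow> br (E i) (H j) = - (of_int (cartan_e6 j i) *s E i)"
  by (simp add: br_anti[of "E i"] br_HE)

lemma br_E_cartan_part: "z \<in> cartan_part \<Longrightarrow> i \<in> {1..6} \<Longrightarrow> br (E i) z \<in> nil_part"
  unfolding cartan_part_def
proof (induction rule: vec.span_induct_alt)
  case (step c z w)
  then show ?case using br_E_H E_in_nil_part subspace_nil_part
    by (auto simp del: vector_smult_lneg intro!: vec.subspace_add vec.subspace_neg vec.subspace_scale)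
qed (simp add: subspace_nil_part vec.subspace_0)

text \<open>F_i lowers the degree by one: of the generators only E_i is sent to a nonzero multiple
  of H_i, and longer brackets stay in the nilpotent part.\<close>

lemma br_F_nil_part: "z \<in> nil_part \<Longrightarrow> i \<in> {1..6} \<Longrightarrow> \<exists>c. br (F i) z - c *s H i \<in> nil_part"
  unfolding nil_part_def
proof (induction rule: vec.span_induct_alt)
  case base
  then show ?case by (intro exI[of _ 0]) (simp add: vec.span_zero)
next
  case (step b z w)
  then obtain d where d: "br (F i) w - d *s H i \<in> vec.span (iterated_brackets br E)" by auto
  from step(1) have "\<exists>c. br (F i) z - c *s H i \<in> vec.span (iterated_brackets br E)"
  proof (induction rule: iterated_brackets.induct)
    case (base j)
    have "br (F i) (E j) = (if i = j then - 1 else 0) *s H i"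
      using base step.prems by (simp add: br_anti[of "F i"] br_EF)
    then show ?case by (intro exI[of _ "if i = j then - 1 else 0"]) (simp add: vec.span_zero)
  next
    case (step z j)
    then obtain c p where p: "p \<in> vec.span (iterated_brackets br E)" and "br (F i) z = c *s H i + p"
      by (metis add.commute diff_add_cancel)
    moreover have "br (F i) (E j) = (if i = j then - 1 else 0) *s H i"
      using step \<open>i \<in> {1..6}\<close> by (simp add: br_anti[of "F i"] br_EF)
    ultimately have eq: "br (F i) (br (E j) z)
        = (if i = j then - 1 else 0) *s br (H i) z + c *s br (E j) (H i) + br (E j) p"
      by (subst br_jacobi) simp
    have "br (H i) z \<in> nil_part" "br (E j) (H i) \<in> nil_part" "br (E j) p \<in> nil_part"
      using br_H_nil_part[of z i] br_E_cartan_part[of "H i" j] br_E_nil_part[of p j]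
        step(1,2) \<open>i \<in> {1..6}\<close> p
      unfolding nil_part_def cartan_part_def by (blast intro: vec.span_base)+
    then have "br (F i) (br (E j) z) \<in> nil_part"
      unfolding eq by (intro vec.subspace_add vec.subspace_scale subspace_nil_part)
    then show ?case by (intro exI[of _ 0]) (simp add: nil_part_def)
  qed
  then obtain c where c: "br (F i) z - c *s H i \<in> vec.span (iterated_brackets br E)" ..
  have "br (F i) (b *s z + w) - (b * c + d) *s H i = b *s (br (F i) z - c *s H i) + (br (F i) w - d *s H i)"
    by (simp add: vec_eq_iff algebra_simps)
  then show ?case using c d by (metis vec.span_add vec.span_scale)
qed

section \<open>Orthogonality of the graded pieces under the Killing form\<close>

lemma killing_span_zero:
  assumes "\<And>u v. u \<in> S \<Longrightarrow> v \<in> T \<Longrightarrow> \<kappa> u v = 0" "u \<in> vec.span S" "v \<in> vec.span T"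
  shows "\<kappa> u v = 0"
proof -
  have "\<kappa> u v = 0" if "u \<in> S" for u
    using assms(3) by (induction rule: vec.span_induct_alt) (simp_all add: assms(1) that)
  with assms(2) show ?thesis
    by (induction rule: vec.span_induct_alt[where S=S]) simp_all
qed

lemma killing_degree:
  assumes "br d u = m *s u" "br d v = n *s v" "m + n \<noteq> 0"
  shows "\<kappa> u v = 0"
proof -
  have "\<kappa> (br d u) v = - \<kappa> u (br d v)" by (rule killing_br')
  then have "(m + n) * \<kappa> u v = 0" by (simp add: assms algebra_simps)
  then show ?thesis using assms by simp
qed

lemma killing_nil_nil: "u \<in> nil_part \<Longrightarrow> v \<in> nil_part \<Longrightarrow> \<kappa> u v = 0"
proof (rule killing_span_zero)
  fix u v assume "u \<in> iterated_brackets br E" "v \<in> iterated_brackets br E"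
  then obtain m n :: nat where *: "br (height_element H) u = of_nat m *s u"
    "br (height_element H) v = of_nat n *s v" "m > 0"
    by (meson iterated_brackets_degree)
  show "\<kappa> u v = 0"
  proof (rule killing_degree[OF *(1,2)])
    have "of_nat (m + n) \<noteq> (0::complex)" using *(3) by (subst of_nat_eq_0_iff) simp
    then show "of_nat m + of_nat n \<noteq> (0::complex)" by simp
  qed
qed (simp_all add: nil_part_def)

lemma killing_nil_cartan: "u \<in> nil_part \<Longrightarrow> v \<in> cartan_part \<Longrightarrow> \<kappa> u v = 0"
proof (rule killing_span_zero)
  fix u v assume "u \<in> iterated_brackets br E" "v \<in> H ` {1..6}"
  then obtain m :: nat where *: "br (height_element H) u = of_nat m *s u"
    "br (height_element H) v = 0 *s v" "m > 0"
    using iterated_brackets_degree br_height_H by fastforce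
  then show "\<kappa> u v = 0" by (intro killing_degree[OF *(1,2)]) simp
qed (simp_all add: nil_part_def cartan_part_def)

lemma killing_HH: "i \<in> {1..6} \<Longrightarrow> j \<in> {1..6} \<Longrightarrow> \<kappa> (H i) (H j) = of_int (cartan_e6 j i) * \<kappa> (E i) (F i)"
proof -
  assume ij: "i \<in> {1..6}" "j \<in> {1..6}"
  have "\<kappa> (H i) (H j) = \<kappa> (br (E i) (F i)) (H j)" using ij by (simp add: br_EF)
  also have "\<dots> = \<kappa> (E i) (br (F i) (H j))" by (rule killing_br)
  also have "br (F i) (H j) = of_int (cartan_e6 j i) *s F i"
    using ij by (simp add: br_anti[of "F i"] br_HF)
  finally show ?thesis by simp
qed

end

section \<open>Both halves together: the triangular decomposition of the whole algebra\<close>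

locale e6_killing = killing_dual br x y
  for br :: "complex^'m \<Rightarrow> complex^'m \<Rightarrow> complex^'m" and x y :: "'m \<Rightarrow> complex^'m" +
  fixes E F H :: "nat \<Rightarrow> complex^'m"
  assumes chev: "e6_chevalley br E F H"
begin

sublocale pos: e6_relations br E F H
  using chev by unfold_locales (auto simp: e6_chevalley_def)

sublocale neg: e6_relations br F E "\<lambda>i. - H i"
proof unfold_locales
  fix i j :: nat assume ij: "i \<in> {1..6}" "j \<in> {1..6}"
  show "br (F i) (E j) = (if i = j then - H i else 0)"
    using ij by (simp add: br_anti[of "F i"] pos.br_EF)
qed (simp_all add: pos.br_HH pos.br_HE pos.br_HF)

lemma generated:
  assumes "vec.subspace S" "\<And>u v. u \<in> S \<Longrightarrow> v \<in> S \<Longrightarrow> br u v \<in> S"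
    "\<And>i. i \<in> {1..6} \<Longrightarrow> E i \<in> S" "\<And>i. i \<in> {1..6} \<Longrightarrow> F i \<in> S"
  shows "z \<in> S"
proof -
  have "H i \<in> S" if "i \<in> {1..6}" for i
    using assms(2)[OF assms(3)[OF that] assms(4)[OF that]] that by (simp add: pos.br_EF)
  then have "E ` {1..6} \<union> F ` {1..6} \<union> H ` {1..6} \<subseteq> S" using assms by blast
  then have "S = UNIV"
    using chev assms(1,2) by (simp add: e6_chevalley_def lie_generated_by_def)
  then show ?thesis by simp
qed

text \<open>The centraliser of \<open>z\<close> is a subalgebra containing the generators, hence
  everything; \<open>casimir_adjoint\<close> then writes \<open>z\<close> as a sum of vanishing
  double brackets.\<close>

lemma central_eq_0:
  assumes "\<And>i. i \<in> {1..6} \<Longrightarrow> br (E i) z = 0" "\<And>i. i \<in> {1..6} \<Longrightarrow> br (F i) z = 0"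
  shows "z = 0"
proof -
  have "w \<in> {w. br w z = 0}" for w
  proof (rule generated)
    show "vec.subspace {w. br w z = 0}" by (simp add: vec.subspace_def)
    fix u v assume "u \<in> {w. br w z = 0}" "v \<in> {w. br w z = 0}"
    then show "br u v \<in> {w. br w z = 0}" using br_jacobi[of u v z] by simp
  qed (simp_all add: assms)
  then have "br (y a) z = 0" for a by simp
  then show ?thesis using casimir_adjoint[of z] by simp
qed

lemma neg_cartan_part: "neg.cartan_part = pos.cartan_part"
proof -
  have "- H i \<in> pos.cartan_part" "- (- H i) \<in> neg.cartan_part" if "i \<in> {1..6}" for i
    unfolding pos.cartan_part_def neg.cartan_part_def
    using that by (blast intro: vec.span_neg vec.span_base)+
  then have "(\<lambda>i. - H i) ` {1..6} \<subseteq> pos.cartan_part" "H ` {1..6} \<subseteq> neg.cartan_part"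
    by auto
  then show ?thesis
    unfolding pos.cartan_part_def neg.cartan_part_def
    by (simp add: subset_antisym vec.span_minimal)
qed

text \<open>The span is stable under bracketing with every E_i and F_i. The elements w that map it
  to itself form a subalgebra, hence are everything; so the span is itself a subalgebra containing
  the generators.\<close>

lemma span_triangular:
  "z \<in> vec.span (iterated_brackets br F \<union> (H ` {1..6} \<union> iterated_brackets br E))" (is "_ \<in> ?S")
proof -
  have sub: "pos.nil_part \<subseteq> ?S" "neg.nil_part \<subseteq> ?S" "pos.cartan_part \<subseteq> ?S"
    unfolding pos.nil_part_def neg.nil_part_def pos.cartan_part_def by (intro vec.span_mono; blast)+
  have E: "br (E i) s \<in> ?S" if "s \<in> ?S" and i: "i \<in> {1..6}" for s i
    using that(1)
  proof (induction rule: vec.span_induct_alt)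
    case (step c u v)
    from step(1) have "br (E i) u \<in> ?S"
    proof (elim UnE)
      assume "u \<in> iterated_brackets br F"
      then obtain c where "br (E i) u - c *s (- H i) \<in> neg.nil_part"
        using neg.br_F_nil_part[OF _ i] unfolding neg.nil_part_def by (blast intro: vec.span_base)
      then have "br (E i) u - c *s (- H i) \<in> ?S" using sub by blast
      moreover have "c *s (- H i) \<in> ?S"
        using i by (intro vec.span_scale vec.span_neg vec.span_base) auto
      ultimately show ?thesis using vec.span_add by fastforce
    next
      assume "u \<in> H ` {1..6}"
      then show ?thesis
        using pos.br_E_cartan_part i sub by (auto simp: pos.cartan_part_def vec.span_base)
    next
      assume "u \<in> iterated_brackets br E"
      then show ?thesis using pos.br_E_nil_part i sub by (auto simp: pos.nil_part_def vec.span_base)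
    qed
    then show ?case using step by (auto intro: vec.span_add vec.span_scale)
  qed (simp add: vec.span_zero)
  have F: "br (F i) s \<in> ?S" if "s \<in> ?S" and i: "i \<in> {1..6}" for s i
    using that(1)
  proof (induction rule: vec.span_induct_alt)
    case (step c u v)
    from step(1) have "br (F i) u \<in> ?S"
    proof (elim UnE)
      assume "u \<in> iterated_brackets br E"
      then obtain c where "br (F i) u - c *s H i \<in> pos.nil_part"
        using pos.br_F_nil_part[OF _ i] unfolding pos.nil_part_def by (blast intro: vec.span_base)
      then have "br (F i) u - c *s H i \<in> ?S" using sub by blast
      moreover have "c *s H i \<in> ?S"
        using i by (intro vec.span_scale vec.span_base) auto
      ultimately show ?thesis using vec.span_add by fastforce
    next
      assume "u \<in> H ` {1..6}"
      then have "u \<in> neg.cartan_part" unfolding neg_cartan_part by (simp add: pos.cartan_part_def vec.span_base)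
      then show ?thesis using neg.br_E_cartan_part i sub by auto
    next
      assume "u \<in> iterated_brackets br F"
      then show ?thesis using neg.br_E_nil_part i sub by (auto simp: neg.nil_part_def vec.span_base)
    qed
    then show ?case using step by (auto intro: vec.span_add vec.span_scale)
  qed (simp add: vec.span_zero)
  have ideal: "w \<in> {w. \<forall>s\<in>?S. br w s \<in> ?S}" for w
  proof (rule generated)
    show "vec.subspace {w. \<forall>s\<in>?S. br w s \<in> ?S}"
      by (auto simp: vec.subspace_def vec.span_zero intro: vec.span_add vec.span_scale)
    fix u v assume "u \<in> {w. \<forall>s\<in>?S. br w s \<in> ?S}" "v \<in> {w. \<forall>s\<in>?S. br w s \<in> ?S}"
    then have "br u (br v s) - br v (br u s) \<in> ?S" if "s \<in> ?S" for s
      using that by (auto intro!: vec.span_diff)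
    then show "br u v \<in> {w. \<forall>s\<in>?S. br w s \<in> ?S}" using br_jacobi[of u v] by simp
  qed (use E F in auto)
  show ?thesis
  proof (rule generated)
    show "E i \<in> ?S" "F i \<in> ?S" if "i \<in> {1..6}" for i
      using that by (auto intro!: vec.span_base iterated_brackets.base)
  qed (use ideal in auto)
qed

lemma triangular_decomposition:
  "\<exists>t. case t of (a, b, c) \<Rightarrow> a \<in> neg.nil_part \<and> b \<in> pos.cartan_part \<and> c \<in> pos.nil_part \<and> z = a + (b + c)"
  using span_triangular[of z]
  unfolding vec.span_Un pos.nil_part_def neg.nil_part_def pos.cartan_part_def by auto

text \<open>A mere choice: uniqueness and linearity are not yet known. For the negative part both
  follow below from the Killing form.\<close>

definition "triangular_parts z = (SOME (a, b, c). a \<in> neg.nil_part \<and> b \<in> pos.cartan_part \<and>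
  c \<in> pos.nil_part \<and> z = a + (b + c))"
definition "neg_proj z = fst (triangular_parts z)"
definition "zero_proj z = fst (snd (triangular_parts z))"
definition "pos_proj z = snd (snd (triangular_parts z))"

lemma triangular_parts:
  "neg_proj z \<in> neg.nil_part" "zero_proj z \<in> pos.cartan_part" "pos_proj z \<in> pos.nil_part"
  and triangular_sum: "z = neg_proj z + (zero_proj z + pos_proj z)"
proof -
  have "case triangular_parts z of (a, b, c) \<Rightarrow> a \<in> neg.nil_part \<and> b \<in> pos.cartan_part \<and>
      c \<in> pos.nil_part \<and> z = a + (b + c)"
    unfolding triangular_parts_def by (rule someI_ex[OF triangular_decomposition])
  then show "neg_proj z \<in> neg.nil_part" "zero_proj z \<in> pos.cartan_part" "pos_proj z \<in> pos.nil_part"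
    "z = neg_proj z + (zero_proj z + pos_proj z)"
    unfolding neg_proj_def zero_proj_def pos_proj_def by (auto simp only: case_prod_beta)
qed

lemma killing_zeros:
  "u \<in> pos.nil_part \<Longrightarrow> v \<in> pos.nil_part \<Longrightarrow> \<kappa> u v = 0"
  "u \<in> neg.nil_part \<Longrightarrow> v \<in> neg.nil_part \<Longrightarrow> \<kappa> u v = 0"
  "u \<in> pos.nil_part \<Longrightarrow> v \<in> pos.cartan_part \<Longrightarrow> \<kappa> u v = 0"
  "u \<in> pos.nil_part \<Longrightarrow> v \<in> pos.cartan_part \<Longrightarrow> \<kappa> v u = 0"
  "u \<in> neg.nil_part \<Longrightarrow> v \<in> pos.cartan_part \<Longrightarrow> \<kappa> u v = 0"
  "u \<in> neg.nil_part \<Longrightarrow> v \<in> pos.cartan_part \<Longrightarrow> \<kappa> v u = 0"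
  using pos.killing_nil_nil neg.killing_nil_nil pos.killing_nil_cartan neg.killing_nil_cartan
  by (auto simp: neg_cartan_part killing_sym)

text \<open>n_+ is orthogonal to itself and to the Cartan part, and likewise n_-, so both sides
  equal the pairing of the positive part of u with the negative part of v. By nondegeneracy, this
  adjointness makes the negative part independent of the choice above.\<close>

lemma killing_pos_proj: "\<kappa> (pos_proj u) v = \<kappa> u (neg_proj v)"
proof -
  note u = triangular_parts[of u] and v = triangular_parts[of v]
  have "\<kappa> (pos_proj u) v = \<kappa> (pos_proj u) (neg_proj v)"
    by (subst triangular_sum[of v]) (simp add: killing_zeros u v)
  also have "\<dots> = \<kappa> u (neg_proj v)"
    by (subst (2) triangular_sum[of u]) (simp add: killing_zeros u v)
  finally show ?thesis .
qed

lemma neg_proj_eqI: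
  assumes "a \<in> neg.nil_part" "b \<in> pos.cartan_part" "c \<in> pos.nil_part"
  shows "neg_proj (a + (b + c)) = a"
proof (rule killing_eqI)
  fix w
  note w = triangular_parts[of w]
  have "\<kappa> (neg_proj (a + (b + c))) w = \<kappa> (a + (b + c)) (pos_proj w)"
    by (metis killing_pos_proj killing_sym)
  also have "\<dots> = \<kappa> a (pos_proj w)" by (simp add: killing_zeros assms w)
  also have "\<dots> = \<kappa> a w" by (subst (2) triangular_sum[of w]) (simp add: killing_zeros assms w)
  finally show "\<kappa> (neg_proj (a + (b + c))) w = \<kappa> a w" .
qed

lemma neg_proj_linear: "neg_proj (u + v) = neg_proj u + neg_proj v" "neg_proj (c *s u) = c *s neg_proj u"
proof -
  have *: "\<kappa> (neg_proj u) w = \<kappa> u (pos_proj w)" for u w by (metis killing_pos_proj killing_sym)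
  show "neg_proj (u + v) = neg_proj u + neg_proj v" "neg_proj (c *s u) = c *s neg_proj u"
    by (rule killing_eqI; simp add: *)+
qed

section \<open>The scale k of the Killing form\<close>

definition "killing_scale = \<kappa> (E 1) (F 1)"

text \<open>Symmetry of \<kappa>(H_i, H_j) and of the Cartan matrix equates the values at adjacent
  nodes, and the Dynkin diagram is connected.\<close>

lemma killing_EF: "i \<in> {1..6} \<Longrightarrow> \<kappa> (E i) (F i) = killing_scale"
proof -
  have *: "of_int (cartan_e6 j i) * \<kappa> (E i) (F i) = of_int (cartan_e6 j i) * \<kappa> (E j) (F j)"
    if "i \<in> {1..6}" "j \<in> {1..6}" for i j
    using pos.killing_HH[OF that] pos.killing_HH[OF that(2,1)] killing_sym[of "H i" "H j"]
      cartan_e6_sym[of i j] by metis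
  have "\<kappa> (E 3) (F 3) = killing_scale" using *[of 1 3] by (simp add: cartan_e6_simps killing_scale_def)
  moreover have "\<kappa> (E 4) (F 4) = \<kappa> (E 3) (F 3)" using *[of 3 4] by (simp add: cartan_e6_simps)
  moreover have "\<kappa> (E 5) (F 5) = \<kappa> (E 4) (F 4)" using *[of 4 5] by (simp add: cartan_e6_simps)
  moreover have "\<kappa> (E 6) (F 6) = \<kappa> (E 5) (F 5)" using *[of 5 6] by (simp add: cartan_e6_simps)
  moreover have "\<kappa> (E 2) (F 2) = \<kappa> (E 4) (F 4)" using *[of 4 2] by (simp add: cartan_e6_simps)
  ultimately show "i \<in> {1..6} \<Longrightarrow> \<kappa> (E i) (F i) = killing_scale" by (auto simp: interval_1_6 killing_scale_def)
qed

lemma killing_HH: "i \<in> {1..6} \<Longrightarrow> j \<in> {1..6} \<Longrightarrow> \<kappa> (H i) (H j) = of_int (cartan_e6 i j) * killing_scale"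
  using pos.killing_HH[of i j] killing_EF[of i] cartan_e6_sym[of i j] by simp

lemma H_in_cartan: "i \<in> {1..6} \<Longrightarrow> H i \<in> pos.cartan_part"
  by (simp add: pos.cartan_part_def vec.span_base)

text \<open>If k were 0, each H_i would be orthogonal to the Cartan part, hence to everything, and
  so vanish. Then [H_i, E_i] = 2 E_i and its analogue for F_i kill all generators, and the bracket
  would be zero.\<close>

lemma killing_scale_nonzero: "killing_scale \<noteq> 0"
proof
  assume "killing_scale = 0"
  have H0: "H i = 0" if i: "i \<in> {1..6}" for i
  proof (rule killing_nondegenerate)
    fix w
    note w = triangular_parts[of w]
    have "\<kappa> (H i) b = 0" if "b \<in> pos.cartan_part" for b
      using that unfolding pos.cartan_part_def
      by (induction rule: vec.span_induct_alt) (use \<open>killing_scale = 0\<close> i in \<open>auto simp: killing_HH\<close>)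
    then show "\<kappa> (H i) w = 0" by (subst triangular_sum[of w]) (simp add: killing_zeros H_in_cartan[OF i] w)
  qed
  have EF0: "E i = 0 \<and> F i = 0" if i: "i \<in> {1..6}" for i
    using pos.br_HE[OF i i] pos.br_HF[OF i i] by (simp add: H0[OF i] cartan_e6_simps)
  have "z \<in> {0}" for z :: "complex^'m"
    by (rule generated) (use EF0 in auto)
  then have "br u v = 0" for u v by blast
  then show False using chev by (auto simp: e6_chevalley_def simple_lie_algebra_def)
qed

text \<open>Bracketing with E_i fails to commute with the projection only because part of the
  negative component can be sent to a multiple of H_i, which the projection discards.\<close>

lemma neg_proj_ad_E:
  assumes i: "i \<in> {1..6}"
  shows "br (E i) (neg_proj w) - neg_proj (br (E i) w) = (\<kappa> (E i) w / killing_scale) *s H i"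
proof -
  note w = triangular_parts[of w]
  obtain c where c: "br (E i) (neg_proj w) - c *s (- H i) \<in> neg.nil_part"
    using neg.br_F_nil_part[OF w(1) i] by blast
  define a where "a = br (E i) (neg_proj w) - c *s (- H i)"
  have a: "a \<in> neg.nil_part" using c by (simp add: a_def)
  have aw: "br (E i) (neg_proj w) = a + (- c) *s H i" by (simp add: a_def)
  have "neg_proj (a + ((- c) *s H i + (br (E i) (zero_proj w) + br (E i) (pos_proj w)))) = a"
  proof (rule neg_proj_eqI[OF a])
    show "(- c) *s H i \<in> pos.cartan_part"
      unfolding pos.cartan_part_def by (intro vec.span_scale vec.span_base imageI i)
    show "br (E i) (zero_proj w) + br (E i) (pos_proj w) \<in> pos.nil_part"
      using pos.br_E_cartan_part[OF w(2) i] pos.br_E_nil_part[OF w(3) i]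
      by (rule vec.subspace_add[OF pos.subspace_nil_part])
  qed
  moreover have "br (E i) w = a + ((- c) *s H i + (br (E i) (zero_proj w) + br (E i) (pos_proj w)))"
    by (subst triangular_sum[of w]) (simp add: aw)
  ultimately have "neg_proj (br (E i) w) = a" by simp
  then have 1: "br (E i) (neg_proj w) - neg_proj (br (E i) w) = (- c) *s H i" by (simp add: aw)
  \<comment> \<open>The coefficient is found by evaluating one pairing with H_i in two ways, using
    \<kappa>(H_i, H_i) = 2k.\<close>
  have "\<kappa> (br (E i) (neg_proj w)) (H i) = - c * (2 * killing_scale)"
    unfolding aw by (simp add: killing_zeros(5)[OF a H_in_cartan[OF i]] killing_HH[OF i i] cartan_e6_simps)
  moreover have "\<kappa> (br (E i) (neg_proj w)) (H i) = 2 * \<kappa> (neg_proj w) (E i)"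
    by (subst killing_br') (simp add: pos.br_E_H[OF i i] cartan_e6_simps)
  moreover have "\<kappa> (neg_proj w) (E i) = \<kappa> (E i) w"
  proof -
    have "\<kappa> (E i) w = \<kappa> (E i) (neg_proj w + (zero_proj w + pos_proj w))"
      by (rule arg_cong[OF triangular_sum])
    also have "\<dots> = \<kappa> (E i) (neg_proj w)"
      by (simp add: killing_zeros(1)[OF pos.E_in_nil_part[OF i] w(3)]
          killing_zeros(3)[OF pos.E_in_nil_part[OF i] w(2)])
    also have "\<dots> = \<kappa> (neg_proj w) (E i)" by (rule killing_sym)
    finally show ?thesis ..
  qed
  ultimately have "- c * (2 * killing_scale) = 2 * \<kappa> (E i) w" by metis
  then have "- c * killing_scale = \<kappa> (E i) w"
    by (metis mult.left_commute mult_cancel_left zero_neq_numeral)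
  then have "- c = \<kappa> (E i) w / killing_scale" using killing_scale_nonzero by (metis nonzero_mult_div_cancel_right)
  then show ?thesis using 1 by simp
qed

text \<open>Here the defect comes from the Cartan component of w, which F_i moves into n_-. On the
  Cartan part, \<kappa>(H_i, _)/k is the i-th simple root.\<close>

lemma neg_proj_ad_F:
  assumes i: "i \<in> {1..6}"
  shows "br (F i) (neg_proj w) - neg_proj (br (F i) w) = - ((\<kappa> (H i) w / killing_scale) *s F i)"
proof -
  note w = triangular_parts[of w]
  obtain c where c: "br (F i) (pos_proj w) - c *s H i \<in> pos.nil_part"
    using pos.br_F_nil_part[OF w(3) i] by blast
  define a where "a = br (F i) (pos_proj w) - c *s H i"
  have a: "a \<in> pos.nil_part" using c by (simp add: a_def)
  have aw: "br (F i) (pos_proj w) = c *s H i + a" by (simp add: a_def)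
  have "neg_proj ((br (F i) (neg_proj w) + br (F i) (zero_proj w)) + (c *s H i + a))
      = br (F i) (neg_proj w) + br (F i) (zero_proj w)"
  proof (rule neg_proj_eqI[OF _ _ a])
    show "c *s H i \<in> pos.cartan_part"
      unfolding pos.cartan_part_def by (intro vec.span_scale vec.span_base imageI i)
    show "br (F i) (neg_proj w) + br (F i) (zero_proj w) \<in> neg.nil_part"
      using neg.br_E_nil_part[OF w(1) i] neg.br_E_cartan_part[OF w(2)[folded neg_cartan_part] i]
      by (rule vec.subspace_add[OF neg.subspace_nil_part])
  qed
  moreover have "br (F i) w = (br (F i) (neg_proj w) + br (F i) (zero_proj w)) + (c *s H i + a)"
    by (subst triangular_sum[of w]) (simp add: aw)
  ultimately have "neg_proj (br (F i) w) = br (F i) (neg_proj w) + br (F i) (zero_proj w)" by simp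
  then have 1: "br (F i) (neg_proj w) - neg_proj (br (F i) w) = - br (F i) (zero_proj w)" by simp
  have "br (F i) b = (\<kappa> (H i) b / killing_scale) *s F i" if "b \<in> pos.cartan_part" for b
    using that unfolding pos.cartan_part_def
  proof (induction rule: vec.span_induct_alt)
    case (step d u v)
    then obtain j where j: "j \<in> {1..6}" "u = H j" by auto
    then have "br (F i) u = (\<kappa> (H i) u / killing_scale) *s F i"
      using killing_scale_nonzero i cartan_e6_sym[of i j] by (simp add: killing_HH br_anti[of "F i"] pos.br_HF)
    then show ?case using step by (simp add: vec_eq_iff algebra_simps add_divide_distrib)
  qed simp
  moreover have "\<kappa> (H i) (zero_proj w) = \<kappa> (H i) w"
    using killing_zeros(4)[OF w(3) H_in_cartan[OF i]] killing_zeros(6)[OF w(1) H_in_cartan[OF i]]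
    by (subst (2) triangular_sum[of w]) simp
  ultimately show ?thesis using 1 w(2) by simp
qed

text \<open>This is the \<kappa>-dual of 2\<delta>: in a basis of root vectors each positive root
  would contribute its own \<kappa>-dual. Invariance of the Casimir tensor reduces the brackets with
  E_i and F_i to the projection defects above; the difference of the two sides is then central,
  hence zero.\<close>

lemma sum_dual_br_neg_proj:
  "(\<Sum>a\<in>UNIV. br (x a) (neg_proj (y a))) = (2 / killing_scale) *s height_element H" (is "?T = _")
proof -
  have f: "balanced_bilinear (\<lambda>u v. br u (neg_proj v))"
    by (simp add: balanced_bilinear_def neg_proj_linear)
  have br_T: "br z ?T = (\<Sum>a\<in>UNIV. br (x a) (br z (neg_proj (y a)) - neg_proj (br z (y a))))" for z
  proof -
    have "br z ?T = (\<Sum>a\<in>UNIV. br (br z (x a)) (neg_proj (y a))) + (\<Sum>a\<in>UNIV. br (x a) (br z (neg_proj (y a))))"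
      by (simp add: br_sum br_jacobi[of z] sum.distrib)
    moreover have "(\<Sum>a\<in>UNIV. br (br z (x a)) (neg_proj (y a))) = - (\<Sum>a\<in>UNIV. br (x a) (neg_proj (br z (y a))))"
      using sum_dual_ad[OF f, of z] by (simp add: eq_neg_iff_add_eq_0)
    ultimately show ?thesis by (simp add: sum_subtractf)
  qed
  have "?T - (2 / killing_scale) *s height_element H = 0"
  proof (rule central_eq_0)
    fix i :: nat assume i: "i \<in> {1..6}"
    \<comment> \<open>Every defect is a multiple of the same H_i, so its coefficients can be
      collected on the x_a, where they reassemble E_i.\<close>
    have "br (E i) ?T = br (\<Sum>a\<in>UNIV. \<kappa> (E i) (y a) *s x a) ((1 / killing_scale) *s H i)"
      unfolding br_T neg_proj_ad_E[OF i] by (simp add: br_sum vec.scale_sum_right)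
    also have "\<dots> = - ((2 / killing_scale) *s E i)"
      by (simp add: pos.br_E_H[OF i i] cartan_e6_simps flip: expand_x)
    finally have "br (E i) ?T = - ((2 / killing_scale) *s E i)" .
    moreover have "br (E i) (height_element H) = - E i"
      by (subst br_anti) (simp add: pos.br_height_E[OF i])
    ultimately show "br (E i) (?T - (2 / killing_scale) *s height_element H) = 0" by simp
    have "br (F i) ?T = - br (\<Sum>a\<in>UNIV. \<kappa> (H i) (y a) *s x a) ((1 / killing_scale) *s F i)"
      unfolding br_T neg_proj_ad_F[OF i] by (simp add: br_sum vec.scale_sum_right sum_negf)
    also have "\<dots> = (2 / killing_scale) *s F i"
      by (simp add: pos.br_HF[OF i i] cartan_e6_simps flip: expand_x)
    finally have "br (F i) ?T = (2 / killing_scale) *s F i" .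
    moreover have "br (F i) (height_element H) = F i"
    proof -
      have "height_element (\<lambda>i. - H i) = - height_element H" by (simp add: height_element_def)
      then show ?thesis using neg.br_height_E[OF i] br_anti[of "F i" "height_element H"] by simp
    qed
    ultimately show "br (F i) (?T - (2 / killing_scale) *s height_element H) = 0" by simp
  qed
  then show ?thesis by simp
qed

end

section \<open>Kronecker products and the flip\<close>

lemma sum_UNIV_prod: "(\<Sum>p\<in>(UNIV::('a::finite \<times> 'b::finite) set). f p) = (\<Sum>i\<in>UNIV. \<Sum>j\<in>UNIV. f (i, j))"
  by (simp add: sum.cartesian_product flip: UNIV_Times_UNIV)

lemma kron_mult: "kron A B ** kron C D = kron (A ** C) (B ** (D :: 'a::comm_semiring_1^'n^'n))"
  by (simp add: vec_eq_iff kron_def matrix_matrix_mult_def sum_UNIV_prod sum_product mult_ac)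

lemma kron_add_left: "kron (A + B) C = kron A C + kron B (C :: 'a::comm_ring_1^'n^'n)"
  and kron_add_right: "kron C (A + B) = kron C A + kron C B"
  and kron_diff_left: "kron (A - B) C = kron A C - kron B C"
  and kron_diff_right: "kron C (A - B) = kron C A - kron C B"
  and kron_scale_left: "kron (c *\<^sub>m A) C = c *\<^sub>m kron A C"
  and kron_scale_right: "kron A (c *\<^sub>m C) = c *\<^sub>m kron A C"
  by (simp_all add: vec_eq_iff kron_def algebra_simps)

lemma kron_zero [simp]: "kron 0 A = 0" "kron A 0 = (0 :: 'a::comm_ring_1^('n::finite\<times>'n)^('n\<times>'n))"
  by (simp_all add: vec_eq_iff kron_def)

lemma kron_sum_left: "kron (\<Sum>i\<in>I. f i) C = (\<Sum>i\<in>I. kron (f i) (C :: 'a::comm_ring_1^'n^'n))"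
  and kron_sum_right: "kron C (\<Sum>i\<in>I. f i) = (\<Sum>i\<in>I. kron C (f i))"
  by (induction I rule: infinite_finite_induct) (simp_all add: kron_add_left kron_add_right)

lemma kron_mat_1 [simp]: "kron (mat 1) (mat 1) = (mat 1 :: 'a::comm_ring_1^('n::finite\<times>'n)^('n\<times>'n))"
  by (auto simp: vec_eq_iff kron_def mat_def prod_eq_iff)

lemma trace_kron: "trace (kron A B) = trace A * trace (B :: 'a::comm_ring_1^'n^'n)"
  by (simp add: trace_def kron_def sum_UNIV_prod sum_product)

lemma flip_matrix_mult_left: "(flip_matrix ** A) $ p $ s = (A :: 'a::comm_ring_1^('n::finite\<times>'n)^('n\<times>'n)) $ prod.swap p $ s"
proof -
  have "p = prod.swap k \<longleftrightarrow> k = prod.swap p" for k by auto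
  then have "(flip_matrix ** A) $ p $ s = (\<Sum>k\<in>UNIV. if k = prod.swap p then A $ k $ s else 0)"
    by (simp add: matrix_matrix_mult_def flip_matrix_def if_distrib if_distribR cong: if_cong)
  then show ?thesis by simp
qed

lemma flip_matrix_mult_right: "((A :: 'a::comm_ring_1^('n::finite\<times>'n)^('n\<times>'n)) ** flip_matrix) $ p $ s = A $ p $ prod.swap s"
proof -
  have "(A ** flip_matrix) $ p $ s = (\<Sum>k\<in>UNIV. if k = prod.swap s then A $ p $ k else 0)"
    by (simp add: matrix_matrix_mult_def flip_matrix_def if_distrib if_distribR cong: if_cong)
  then show ?thesis by simp
qed

lemma flip_kron: "flip_matrix ** kron A B = kron B A ** (flip_matrix :: 'a::comm_ring_1^('n::finite\<times>'n)^('n\<times>'n))"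
  by (simp add: vec_eq_iff flip_matrix_mult_left flip_matrix_mult_right kron_def mult.commute)

lemma flip_flip: "flip_matrix ** flip_matrix = (mat 1 :: 'a::comm_ring_1^('n::finite\<times>'n)^('n\<times>'n))"
  unfolding vec_eq_iff flip_matrix_mult_left by (auto simp: flip_matrix_def mat_def prod_eq_iff)

text \<open>Through this identity, traces with the flip on V \<otimes> V become traces of Casimir
  sums on V.\<close>

lemma trace_flip_kron: "trace (flip_matrix ** kron A B) = trace ((A :: 'a::comm_ring_1^'n^'n) ** B)"
  unfolding trace_def flip_matrix_mult_left sum_UNIV_prod
  by (subst sum.swap) (simp add: kron_def matrix_matrix_mult_def)


section \<open>Casimir operators\<close>

text \<open>Schur's lemma starting from one known eigenvector: the eigenvectors of \<open>M\<close>
  in \<open>S\<close> form a nonzero subrepresentation.\<close>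

lemma irreducible_scalar:
  assumes "irreducible_subrep \<sigma> S" "v \<in> S" "v \<noteq> 0" "M *v v = c *s v"
    and comm: "\<And>z. M ** \<sigma> z = \<sigma> z ** M" and "w \<in> S"
  shows "M *v w = c *s w"
proof -
  let ?T = "{w \<in> S. M *v w = c *s w}"
  have "M *v (\<sigma> z *v u) = \<sigma> z *v (M *v u)" for z u
    by (simp add: matrix_vector_mul_assoc comm)
  then have "subrepresentation \<sigma> ?T"
    using assms(1) unfolding irreducible_subrep_def subrepresentation_def
    by (auto simp: vec.subspace_def matrix_vector_right_distrib vec.scale vec.scale_right_distrib mult.commute)
  moreover have "?T \<noteq> {0}" using assms(2-4) by blast
  ultimately have "?T = S" using assms(1) unfolding irreducible_subrep_def by blast
  then show ?thesis using assms(6) by blast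
qed

lemma lie_representation_simps:
  assumes "lie_representation br \<sigma>"
  shows "\<sigma> (u + v) = \<sigma> u + \<sigma> v" "\<sigma> (c *s u) = c *\<^sub>m \<sigma> u" "\<sigma> (br u v) = \<sigma> u ** \<sigma> v - \<sigma> v ** \<sigma> u"
    "\<sigma> 0 = 0" "\<sigma> (\<Sum>i\<in>I. f i) = (\<Sum>i\<in>I. \<sigma> (f i))"
proof -
  show add: "\<sigma> (u + v) = \<sigma> u + \<sigma> v" and "\<sigma> (c *s u) = c *\<^sub>m \<sigma> u"
    "\<sigma> (br u v) = \<sigma> u ** \<sigma> v - \<sigma> v ** \<sigma> u" for u v
    using assms by (auto simp: lie_representation_def)
  show 0: "\<sigma> 0 = 0" using add[of 0 0] by simp
  show "\<sigma> (\<Sum>i\<in>I. f i) = (\<Sum>i\<in>I. \<sigma> (f i))"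
    by (induction I rule: infinite_finite_induct) (simp_all add: add 0)
qed

lemma lie_representation_tensor_square:
  assumes "lie_representation br \<rho>"
  shows "lie_representation br (tensor_square \<rho>)"
  unfolding lie_representation_def tensor_square_def lie_representation_simps(1-3)[OF assms]
    kron_add_left kron_add_right kron_scale_left kron_scale_right kron_diff_left
    kron_diff_right matrix_add_ldistrib matrix_add_rdistrib' kron_mult
  by (simp add: algebra_simps)

lemma flip_tensor_square: "flip_matrix ** tensor_square \<rho> z = tensor_square \<rho> z ** flip_matrix"
  by (simp add: tensor_square_def matrix_add_ldistrib matrix_add_rdistrib' flip_kron add.commute)

context e6_killing
begin

definition "casimir \<sigma> = (\<Sum>a\<in>UNIV. \<sigma> (x a) ** \<sigma> (y a))"

context
  fixes \<sigma> :: "complex^'m \<Rightarrow> complex^'k^'k"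
  assumes rep: "lie_representation br \<sigma>"
begin

lemmas rep_simps = lie_representation_simps[OF rep]

lemma balanced_bilinear_rep: "balanced_bilinear (\<lambda>u v. \<sigma> u ** \<sigma> v)"
  by (simp add: balanced_bilinear_def rep_simps matrix_add_ldistrib matrix_add_rdistrib')

lemma casimir_commute: "casimir \<sigma> ** \<sigma> z = \<sigma> z ** casimir \<sigma>"
proof -
  have "\<sigma> z ** casimir \<sigma> - casimir \<sigma> ** \<sigma> z
      = (\<Sum>a\<in>UNIV. \<sigma> (br z (x a)) ** \<sigma> (y a)) + (\<Sum>a\<in>UNIV. \<sigma> (x a) ** \<sigma> (br z (y a)))"
    unfolding casimir_def matrix_sum_ldistrib matrix_sum_rdistrib sum_subtractf[symmetric] sum.distrib[symmetric]
    by (rule sum.cong) (simp_all add: rep_simps matrix_sub_ldistrib matrix_sub_rdistrib matrix_mul_assoc)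
  also have "\<dots> = 0" by (rule sum_dual_ad[OF balanced_bilinear_rep])
  finally show ?thesis by simp
qed

text \<open>\<open>c\<close> holds the coordinates of \<mu> in the simple roots, so the two sums are
  (\<mu>, \<mu>) and (\<mu>, 2\<delta>) for the form in which simple roots have square length 2. On
  \<open>v\<close> the positive part of y_a acts by zero, its Cartan part yields (\<mu>, \<mu>), and
  commuting its negative part past x_a yields (\<mu>, 2\<delta>).\<close>

lemma casimir_highest_weight:
  assumes v: "\<And>i. i \<in> {1..6} \<Longrightarrow> \<sigma> (E i) *v v = 0" "\<And>i. i \<in> {1..6} \<Longrightarrow> \<sigma> (H i) *v v = \<mu> i *s v"
    and c: "\<And>i. i \<in> {1..6} \<Longrightarrow> (\<Sum>j\<in>{1..6}. of_int (cartan_e6 i j) * c j) = \<mu> i"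
  shows "casimir \<sigma> *v v = (((\<Sum>j\<in>{1..6}. c j * \<mu> j)
    + 2 * (8 * \<mu> 1 + 11 * \<mu> 2 + 15 * \<mu> 3 + 21 * \<mu> 4 + 15 * \<mu> 5 + 8 * \<mu> 6)) / killing_scale) *s v"
proof -
  have nil: "\<sigma> z *v v = 0" if "z \<in> pos.nil_part" for z
    using that unfolding pos.nil_part_def
  proof (induction rule: vec.span_induct_alt)
    case (step d u w)
    from step(1) have "\<sigma> u *v v = 0"
      by (induction rule: iterated_brackets.induct)
        (simp_all add: v rep_simps matrix_vector_mult_diff_rdistrib flip: matrix_vector_mul_assoc)
    then show ?case using step by (simp add: rep_simps matrix_vector_mult_add_rdistrib)
  qed (simp add: rep_simps)
  \<comment> \<open>The element of the Cartan part that represents \<mu> through \<kappa>.\<close>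
  define t where "t = (\<Sum>j\<in>{1..6}. (c j / killing_scale) *s H j)"
  have t: "t \<in> pos.cartan_part"
    unfolding t_def pos.cartan_part_def by (intro vec.span_sum vec.span_scale vec.span_base imageI)
  have t_H: "\<kappa> t (H i) = \<mu> i" if i: "i \<in> {1..6}" for i
  proof -
    have "\<kappa> t (H i) = (\<Sum>j\<in>{1..6}. of_int (cartan_e6 i j) * c j)"
      unfolding t_def killing_sum
    proof (rule sum.cong[OF refl])
      fix j :: nat assume j: "j \<in> {1..6}"
      show "\<kappa> ((c j / killing_scale) *s H j) (H i) = of_int (cartan_e6 i j) * c j"
        using killing_scale_nonzero by (simp add: killing_HH[OF j i] cartan_e6_sym[of j i])
    qed
    then show ?thesis by (simp add: c[OF i])
  qed
  have cartan: "\<sigma> z *v v = \<kappa> t z *s v" if "z \<in> pos.cartan_part" for z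
    using that unfolding pos.cartan_part_def
  proof (induction rule: vec.span_induct_alt)
    case (step d u w)
    from step(1) have "\<sigma> u *v v = \<kappa> t u *s v" using v(2) t_H by auto
    then show ?case using step by (simp add: rep_simps matrix_vector_mult_add_rdistrib vec_eq_iff algebra_simps)
  qed (simp add: rep_simps)
  have split: "\<sigma> z *v v = \<sigma> (neg_proj z) *v v + \<kappa> t z *s v" for z
  proof -
    have "\<sigma> z *v v = \<sigma> (neg_proj z + (zero_proj z + pos_proj z)) *v v"
      by (rule arg_cong[OF triangular_sum])
    moreover have "\<kappa> t z = \<kappa> t (neg_proj z + (zero_proj z + pos_proj z))"
      by (rule arg_cong[OF triangular_sum])
    ultimately show ?thesis
      using nil[OF triangular_parts(3)] cartan[OF triangular_parts(2)]
        killing_zeros(4)[OF triangular_parts(3) t] killing_zeros(6)[OF triangular_parts(1) t]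
      by (simp add: rep_simps matrix_vector_mult_add_rdistrib)
  qed
  \<comment> \<open>Adjointness replaces the negative part of y_a by the positive part of x_a, which
    annihilates \<open>v\<close>.\<close>
  have "(\<Sum>a\<in>UNIV. \<sigma> (neg_proj (y a)) *v (\<sigma> (x a) *v v))
      = (\<Sum>a\<in>UNIV. \<sigma> (y a) *v (\<sigma> (pos_proj (x a)) *v v))"
    by (rule sum_dual_adjoint[symmetric, where f = "\<lambda>z w. \<sigma> w *v (\<sigma> z *v v)"])
      (simp_all add: killing_pos_proj balanced_bilinear_def rep_simps matrix_vector_mult_add_rdistrib
        matrix_vector_right_distrib vec.scale)
  also have "\<dots> = 0" by (simp add: nil[OF triangular_parts(3)])
  finally have neg: "(\<Sum>a\<in>UNIV. \<sigma> (neg_proj (y a)) *v (\<sigma> (x a) *v v)) = 0" .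
  have "casimir \<sigma> *v v = (\<Sum>a\<in>UNIV. \<sigma> (x a) *v (\<sigma> (y a) *v v))"
    by (simp add: casimir_def matrix_sum_vector matrix_vector_mul_assoc)
  also have "\<dots> = (\<Sum>a\<in>UNIV. \<sigma> (x a) *v (\<sigma> (neg_proj (y a)) *v v))
      + (\<Sum>a\<in>UNIV. \<kappa> t (y a) *s (\<sigma> (x a) *v v))"
    by (subst split) (simp add: matrix_vector_right_distrib vec.scale sum.distrib)
  also have "(\<Sum>a\<in>UNIV. \<kappa> t (y a) *s (\<sigma> (x a) *v v)) = \<sigma> (\<Sum>a\<in>UNIV. \<kappa> t (y a) *s x a) *v v"
    by (simp add: rep_simps matrix_sum_vector)
  also have "\<dots> = \<kappa> t t *s v" by (simp add: cartan[OF t] flip: expand_x)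
  also have "\<kappa> t t = (\<Sum>j\<in>{1..6}. c j * \<mu> j) / killing_scale"
    by (subst (2) t_def) (simp add: killing_sum t_H sum_divide_distrib)
  also have "(\<Sum>a\<in>UNIV. \<sigma> (x a) *v (\<sigma> (neg_proj (y a)) *v v))
      = (\<Sum>a\<in>UNIV. \<sigma> (br (x a) (neg_proj (y a))) *v v)
        + (\<Sum>a\<in>UNIV. \<sigma> (neg_proj (y a)) *v (\<sigma> (x a) *v v))"
    by (simp add: rep_simps matrix_vector_mult_diff_rdistrib matrix_vector_mul_assoc flip: sum.distrib)
  also have "\<dots> = \<sigma> (\<Sum>a\<in>UNIV. br (x a) (neg_proj (y a))) *v v"
    by (simp add: neg rep_simps(5) matrix_sum_vector)
  also have "\<dots> = (2 * (8 * \<mu> 1 + 11 * \<mu> 2 + 15 * \<mu> 3 + 21 * \<mu> 4 + 15 * \<mu> 5 + 8 * \<mu> 6) / killing_scale) *s v"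
    unfolding sum_dual_br_neg_proj height_element_def
    by (simp add: rep_simps matrix_vector_mult_add_rdistrib v(2) vec_eq_iff field_simps add_divide_distrib)
  finally show ?thesis by (simp add: vec_eq_iff add_divide_distrib distrib_right add.commute)
qed

lemma casimir_irreducible:
  assumes irrep: "irrep_highest_weight E H \<sigma> S wt" and w: "w \<in> S"
    and c: "\<And>i. i \<in> {1..6} \<Longrightarrow> (\<Sum>j\<in>{1..6}. of_int (cartan_e6 i j) * c j) = of_nat (wt ! (i - 1))"
  shows "casimir \<sigma> *v w = (((\<Sum>j\<in>{1..6}. c j * of_nat (wt ! (j - 1)))
    + 2 * (8 * of_nat (wt ! 0) + 11 * of_nat (wt ! 1) + 15 * of_nat (wt ! 2) + 21 * of_nat (wt ! 3)
      + 15 * of_nat (wt ! 4) + 8 * of_nat (wt ! 5))) / killing_scale) *s w"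
proof -
  obtain v where v: "v \<in> S" "v \<noteq> 0"
    "\<And>i. i \<in> {1..6} \<Longrightarrow> \<sigma> (E i) *v v = 0"
    "\<And>i. i \<in> {1..6} \<Longrightarrow> \<sigma> (H i) *v v = of_nat (wt ! (i - 1)) *s v"
    and S: "irreducible_subrep \<sigma> S"
    using irrep unfolding irrep_highest_weight_def has_highest_weight_def by auto
  show ?thesis
    using irreducible_scalar[OF S v(1,2) casimir_highest_weight[OF v(3,4) c] casimir_commute w]
    by (simp add: One_nat_def)
qed

text \<open>Traces vanish on brackets, and E_i and F_i are multiples of their brackets with
  H_i.\<close>

lemma trace_rep: "trace (\<sigma> z) = 0"
proof -
  have comm: "trace (\<sigma> (br u v)) = 0" for u v
    by (simp add: rep_simps trace_sub trace_mul_sym[of "\<sigma> u"])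
  have "z \<in> {z. trace (\<sigma> z) = 0}"
  proof (rule generated)
    show "vec.subspace {z. trace (\<sigma> z) = 0}"
      by (simp add: vec.subspace_def rep_simps trace_add)
    fix i :: nat assume i: "i \<in> {1..6}"
    show "E i \<in> {z. trace (\<sigma> z) = 0}" "F i \<in> {z. trace (\<sigma> z) = 0}"
      using comm[of "H i" "E i"] comm[of "F i" "H i"] br_anti[of "F i" "H i"] pos.br_HE[OF i i] pos.br_HF[OF i i]
      by (simp_all add: cartan_e6_simps rep_simps(2))
  qed (simp add: comm)
  then show ?thesis by simp
qed

text \<open>Moving \<open>\<sigma> z\<close> to the right leaves c \<open>\<sigma> z\<close> plus
  the correction \<open>?P\<close>. Invariance and symmetry of the Casimir tensor make
  \<open>?P\<close> the negative of its reversal \<open>?Q\<close>, so 2 \<open>?P\<close> is a sum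
  of commutators, which the adjoint Casimir evaluates to \<open>- \<sigma> z\<close>.\<close>

lemma casimir_middle:
  assumes c: "casimir \<sigma> = c *\<^sub>m mat 1"
  shows "(\<Sum>a\<in>UNIV. \<sigma> (x a) ** \<sigma> z ** \<sigma> (y a)) = (c - 1 / 2) *\<^sub>m \<sigma> z"
proof -
  let ?P = "\<Sum>a\<in>UNIV. \<sigma> (x a) ** \<sigma> (br z (y a))"
  let ?Q = "\<Sum>a\<in>UNIV. \<sigma> (br z (y a)) ** \<sigma> (x a)"
  have "(\<Sum>a\<in>UNIV. \<sigma> (br z (x a)) ** \<sigma> (y a)) + ?P = 0"
    by (rule sum_dual_ad[OF balanced_bilinear_rep])
  moreover have "(\<Sum>a\<in>UNIV. \<sigma> (br z (x a)) ** \<sigma> (y a)) = ?Q"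
    by (rule sum_dual_swap)
      (simp add: balanced_bilinear_def rep_simps(1,2) matrix_add_ldistrib matrix_add_rdistrib')
  ultimately have Q: "?Q = - ?P" by (simp add: eq_neg_iff_add_eq_0)
  have "?P - ?Q = \<sigma> (\<Sum>a\<in>UNIV. br (x a) (br z (y a)))"
    by (simp add: rep_simps(3,5) flip: sum_subtractf)
  also have "(\<Sum>a\<in>UNIV. br (x a) (br z (y a))) = - z"
    using casimir_adjoint[of z] by (simp add: br_anti[of z] sum_negf)
  finally have "2 *\<^sub>m ?P = - \<sigma> z"
    using Q rep_simps(2)[of "- 1" z] by (simp add: vec_eq_iff algebra_simps)
  then have P: "?P = (- 1 / 2) *\<^sub>m \<sigma> z" by (simp add: vec_eq_iff field_simps)
  have "(\<Sum>a\<in>UNIV. \<sigma> (x a) ** \<sigma> z ** \<sigma> (y a)) = casimir \<sigma> ** \<sigma> z + ?P"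
    by (simp add: casimir_def rep_simps(3) matrix_sub_ldistrib matrix_sum_rdistrib matrix_mul_assoc
        flip: sum.distrib)
  also have "\<dots> = (c - 1 / 2) *\<^sub>m \<sigma> z" unfolding P c by (simp add: vec_eq_iff algebra_simps)
  finally show ?thesis .
qed

end

section \<open>The Casimir tensor on V \<otimes> V and its traces\<close>

context
  fixes \<rho> :: "complex^'m \<Rightarrow> complex^'n^'n" and c :: complex
  assumes rep: "lie_representation br \<rho>" and c: "casimir \<rho> = c *\<^sub>m mat 1"
begin

lemma omega_tensor_sym: "omega_tensor \<rho> x y = (\<Sum>a\<in>UNIV. kron (\<rho> (y a)) (\<rho> (x a)))"
  unfolding omega_tensor_def
  by (rule sum_dual_swap) (simp add: balanced_bilinear_def lie_representation_simps[OF rep]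
      kron_add_left kron_add_right kron_scale_left kron_scale_right)

lemma flip_omega_tensor: "flip_matrix ** omega_tensor \<rho> x y = omega_tensor \<rho> x y ** flip_matrix"
  by (subst omega_tensor_sym) (simp add: omega_tensor_def matrix_sum_ldistrib matrix_sum_rdistrib flip_kron)

lemma casimir_tensor_square:
  "casimir (tensor_square \<rho>) = (2 * c) *\<^sub>m mat 1 + 2 *\<^sub>m omega_tensor \<rho> x y"
proof -
  have "casimir (tensor_square \<rho>) = kron (casimir \<rho>) (mat 1) + kron (mat 1) (casimir \<rho>)
      + omega_tensor \<rho> x y + (\<Sum>a\<in>UNIV. kron (\<rho> (y a)) (\<rho> (x a)))"
    by (simp add: casimir_def tensor_square_def omega_tensor_def matrix_add_ldistrib matrix_add_rdistrib'
        kron_mult kron_sum_left kron_sum_right sum.distrib algebra_simps)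
  then show ?thesis
    unfolding omega_tensor_sym[symmetric] c
    by (simp add: kron_scale_left kron_scale_right vec_eq_iff algebra_simps)
qed

lemma trace_omega: "trace (omega_tensor \<rho> x y) = 0"
  by (simp add: omega_tensor_def trace_sum trace_kron trace_rep[OF rep])

lemma trace_flip_omega: "trace (flip_matrix ** omega_tensor \<rho> x y) = c * of_nat CARD('n)"
proof -
  have "trace (flip_matrix ** omega_tensor \<rho> x y) = trace (casimir \<rho>)"
    by (simp add: omega_tensor_def casimir_def matrix_sum_ldistrib trace_sum trace_flip_kron)
  then show ?thesis by (simp add: c trace_I)
qed

text \<open>The flip turns the double sum into traces of x_a x_b y_a y_b, where the inner sum over a
  has the shape of \<open>casimir_middle\<close>.\<close>

lemma trace_flip_omega_omega:
  "trace (flip_matrix ** (omega_tensor \<rho> x y ** omega_tensor \<rho> x y)) = c * (c - 1 / 2) * of_nat CARD('n)"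
proof -
  have "trace (flip_matrix ** (omega_tensor \<rho> x y ** omega_tensor \<rho> x y))
      = (\<Sum>b\<in>UNIV. \<Sum>a\<in>UNIV. trace (\<rho> (x a) ** \<rho> (x b) ** (\<rho> (y a) ** \<rho> (y b))))"
    by (simp add: omega_tensor_def matrix_sum_ldistrib matrix_sum_rdistrib trace_sum
        kron_mult trace_flip_kron)
  also have "\<dots> = (\<Sum>b\<in>UNIV. trace ((\<Sum>a\<in>UNIV. \<rho> (x a) ** \<rho> (x b) ** \<rho> (y a)) ** \<rho> (y b)))"
    by (simp add: matrix_sum_rdistrib trace_sum matrix_mul_assoc)
  also have "\<dots> = (c - 1 / 2) * trace (casimir \<rho>)"
    by (simp add: casimir_middle[OF rep c] casimir_def trace_sum sum_distrib_left)
  finally show ?thesis by (simp add: c trace_I)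
qed

end

end

section \<open>Decompositions into three summands\<close>

text \<open>The fixed vectors of \<open>M\<close> in \<open>S\<close> form a subrepresentation,
  hence are all of \<open>S\<close> or only 0. In the latter case the fixed vector v + M v must
  vanish.\<close>

lemma involution_irreducible:
  assumes S: "irreducible_subrep \<sigma> S" and M: "M ** M = mat 1"
    and comm: "\<And>z. M ** \<sigma> z = \<sigma> z ** M" and MS: "\<And>v. v \<in> S \<Longrightarrow> M *v v \<in> S"
  shows "\<exists>\<epsilon>. (\<epsilon> = 1 \<or> \<epsilon> = - 1) \<and> (\<forall>v\<in>S. M *v v = \<epsilon> *s v)"
proof -
  let ?T = "{v \<in> S. M *v v = v}"
  have sub: "vec.subspace S" using S by (simp add: irreducible_subrep_def subrepresentation_def)
  have "M *v (\<sigma> z *v u) = \<sigma> z *v (M *v u)" for z u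
    by (simp add: matrix_vector_mul_assoc comm)
  then have "subrepresentation \<sigma> ?T"
    using S unfolding irreducible_subrep_def subrepresentation_def
    by (auto simp: vec.subspace_def matrix_vector_right_distrib vec.scale)
  then consider "?T = {0}" | "?T = S"
    using S unfolding irreducible_subrep_def by blast
  then show ?thesis
  proof cases
    case 1
    have "M *v v = (- 1) *s v" if v: "v \<in> S" for v
    proof -
      have "M *v (v + M *v v) = v + M *v v"
        by (simp add: matrix_vector_right_distrib matrix_vector_mul_assoc M add.commute)
      then have "v + M *v v \<in> ?T" using vec.subspace_add[OF sub v MS[OF v]] by simp
      then have "v + M *v v = 0" unfolding 1 by simp
      then show ?thesis by (simp add: eq_neg_iff_add_eq_0 add.commute)
    qed
    then show ?thesis by blast
  next
    case 2
    then have "\<forall>v\<in>S. M *v v = 1 *s v" by auto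
    then show ?thesis by blast
  qed
qed

lemma direct_sum3_unique:
  assumes "direct_sum3 U Y W" "u \<in> U" "y \<in> Y" "w \<in> W" "u' \<in> U" "y' \<in> Y" "w' \<in> W"
    "u + y + w = u' + y' + w'"
  shows "u = u'" "y = y'" "w = w'"
proof -
  have "\<exists>!(u', y', w'). u' \<in> U \<and> y' \<in> Y \<and> w' \<in> W \<and> u + y + w = u' + y' + w'"
    using assms(1) unfolding direct_sum3_def by blast
  then have "(u, y, w) = (u', y', w')"
    by (rule ex1E) (use assms(2-8) in auto)
  then show "u = u'" "y = y'" "w = w'" by auto
qed

text \<open>The projections are carried as matrices, so that operators acting by scalars on the
  summands can be multiplied, traced and exponentiated through three coefficients.\<close>

locale spectral3 =
  fixes U Y W :: "(complex^'k) set" and PU PY PW :: "complex^'k^'k"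
  assumes subspaces: "vec.subspace U" "vec.subspace Y" "vec.subspace W"
    and direct: "direct_sum3 U Y W"
    and proj_in: "\<And>z. PU *v z \<in> U" "\<And>z. PY *v z \<in> Y" "\<And>z. PW *v z \<in> W"
    and proj_sum: "PU + PY + PW = mat 1"

lemma direct_sum3_projections:
  assumes sub: "vec.subspace U" "vec.subspace Y" "vec.subspace W" and dir: "direct_sum3 U Y W"
  obtains PU PY PW where "spectral3 U Y W PU PY PW"
proof -
  have "\<exists>t. fst t \<in> U \<and> fst (snd t) \<in> Y \<and> snd (snd t) \<in> W \<and> z = fst t + fst (snd t) + snd (snd t)" for z
    using dir unfolding direct_sum3_def by fastforce
  then obtain t where t: "\<And>z. fst (t z) \<in> U" "\<And>z. fst (snd (t z)) \<in> Y" "\<And>z. snd (snd (t z)) \<in> W"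
    "\<And>z. fst (t z) + fst (snd (t z)) + snd (snd (t z)) = z" by metis
  define f g h where "f z = fst (t z)" and "g z = fst (snd (t z))" and "h z = snd (snd (t z))" for z
  have fgh: "f z \<in> U" "g z \<in> Y" "h z \<in> W" "f z + g z + h z = z" for z
    using t by (simp_all add: f_def g_def h_def)
  have add: "f (z + z') = f z + f z'" "g (z + z') = g z + g z'" "h (z + z') = h z + h z'" for z z'
  proof -
    have "f (z + z') + g (z + z') + h (z + z') = (f z + g z + h z) + (f z' + g z' + h z')"
      by (simp only: fgh(4))
    also have "\<dots> = (f z + f z') + (g z + g z') + (h z + h z')" by (simp only: add_ac)
    finally have "f (z + z') + g (z + z') + h (z + z') = (f z + f z') + (g z + g z') + (h z + h z')" .
    then show "f (z + z') = f z + f z'" "g (z + z') = g z + g z'" "h (z + z') = h z + h z'"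
      using direct_sum3_unique[OF dir fgh(1) fgh(2) fgh(3)] sub fgh vec.subspace_add by metis+
  qed
  have scale: "f (c *s z) = c *s f z" "g (c *s z) = c *s g z" "h (c *s z) = c *s h z" for c z
  proof -
    have "f (c *s z) + g (c *s z) + h (c *s z) = c *s (f z + g z + h z)"
      by (simp only: fgh(4))
    then have "f (c *s z) + g (c *s z) + h (c *s z) = c *s f z + c *s g z + c *s h z"
      by (simp only: vec.scale_right_distrib)
    then show "f (c *s z) = c *s f z" "g (c *s z) = c *s g z" "h (c *s z) = c *s h z"
      using direct_sum3_unique[OF dir fgh(1) fgh(2) fgh(3)] sub fgh vec.subspace_scale by metis+
  qed
  have lin: "Vector_Spaces.linear (*s) (*s) f" "Vector_Spaces.linear (*s) (*s) g" "Vector_Spaces.linear (*s) (*s) h"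
    by (unfold_locales; simp add: add scale)+
  have "spectral3 U Y W (matrix f) (matrix g) (matrix h)"
    using sub dir fgh by unfold_locales (simp_all add: matrix_works lin matrix_eq matrix_vector_mult_add_rdistrib)
  then show ?thesis by (rule that)
qed

context spectral3
begin

lemma proj_split: "PU *v z + PY *v z + PW *v z = z"
  using arg_cong[OF proj_sum, of "\<lambda>M. M *v z"] by (simp add: matrix_vector_mult_add_rdistrib)

lemma proj_on:
  "u \<in> U \<Longrightarrow> PU *v u = u" "u \<in> U \<Longrightarrow> PY *v u = 0" "u \<in> U \<Longrightarrow> PW *v u = 0"
  "y \<in> Y \<Longrightarrow> PU *v y = 0" "y \<in> Y \<Longrightarrow> PY *v y = y" "y \<in> Y \<Longrightarrow> PW *v y = 0"
  "w \<in> W \<Longrightarrow> PU *v w = 0" "w \<in> W \<Longrightarrow> PY *v w = 0" "w \<in> W \<Longrightarrow> PW *v w = w"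
proof -
  note * = direct_sum3_unique[OF direct proj_in] and 0 = subspaces[THEN vec.subspace_0]
  show "u \<in> U \<Longrightarrow> PU *v u = u" "u \<in> U \<Longrightarrow> PY *v u = 0" "u \<in> U \<Longrightarrow> PW *v u = 0"
    using *[of u 0 0 u u u] proj_split[of u] 0 by simp_all
  show "y \<in> Y \<Longrightarrow> PU *v y = 0" "y \<in> Y \<Longrightarrow> PY *v y = y" "y \<in> Y \<Longrightarrow> PW *v y = 0"
    using *[of 0 y 0 y y y] proj_split[of y] 0 by simp_all
  show "w \<in> W \<Longrightarrow> PU *v w = 0" "w \<in> W \<Longrightarrow> PY *v w = 0" "w \<in> W \<Longrightarrow> PW *v w = w"
    using *[of 0 0 w w w w] proj_split[of w] 0 by simp_all
qed

lemma proj_mult: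
  "PU ** PU = PU" "PY ** PY = PY" "PW ** PW = PW"
  "PU ** PY = 0" "PU ** PW = 0" "PY ** PU = 0" "PY ** PW = 0" "PW ** PU = 0" "PW ** PY = 0"
  by (simp_all add: matrix_eq proj_on proj_in flip: matrix_vector_mul_assoc)

lemma matrix_eq_spectral:
  assumes "\<And>z. z \<in> U \<Longrightarrow> M *v z = a *s z" "\<And>z. z \<in> Y \<Longrightarrow> M *v z = b *s z" "\<And>z. z \<in> W \<Longrightarrow> M *v z = c *s z"
  shows "M = a *\<^sub>m PU + b *\<^sub>m PY + c *\<^sub>m PW"
  unfolding matrix_eq
proof
  fix z
  have "M *v z = M *v (PU *v z + PY *v z + PW *v z)" by (simp add: proj_split)
  then show "M *v z = (a *\<^sub>m PU + b *\<^sub>m PY + c *\<^sub>m PW) *v z"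
    by (simp add: matrix_vector_right_distrib assms proj_in matrix_vector_mult_add_rdistrib)
qed

lemma spectral_mult:
  "(a *\<^sub>m PU + b *\<^sub>m PY + c *\<^sub>m PW) ** (a' *\<^sub>m PU + b' *\<^sub>m PY + c' *\<^sub>m PW)
    = (a * a') *\<^sub>m PU + (b * b') *\<^sub>m PY + (c * c') *\<^sub>m PW"
  by (simp add: matrix_add_ldistrib matrix_add_rdistrib' proj_mult mult.commute)

lemma spectral_pow:
  "matrix_pow (a *\<^sub>m PU + b *\<^sub>m PY + c *\<^sub>m PW) n = (a ^ n) *\<^sub>m PU + (b ^ n) *\<^sub>m PY + (c ^ n) *\<^sub>m PW"
proof (induction n)
  case 0
  then show ?case by (simp add: matrix_pow_def proj_sum)
next
  case (Suc n)
  then show ?case using spectral_mult by (simp add: matrix_pow_def)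
qed

text \<open>As the scalars are distinct, the summands are exactly the eigenspaces of
  \<open>M\<close>, and a commuting \<open>N\<close> preserves those.\<close>

lemma eigenspaces_stable:
  assumes M: "M = a *\<^sub>m PU + b *\<^sub>m PY + c *\<^sub>m PW" and ne: "a \<noteq> b" "a \<noteq> c" "b \<noteq> c"
    and comm: "N ** M = M ** N"
  shows "z \<in> U \<Longrightarrow> N *v z \<in> U" "z \<in> Y \<Longrightarrow> N *v z \<in> Y" "z \<in> W \<Longrightarrow> N *v z \<in> W"
proof -
  have eig: "M *v (N *v z) = d *s (N *v z)" if "M *v z = d *s z" for d
    by (metis comm matrix_vector_mul_assoc that vec.scale)
  have split: "a *s (PU *v t) = d *s (PU *v t)" "b *s (PY *v t) = d *s (PY *v t)"
    "c *s (PW *v t) = d *s (PW *v t)" if "M *v t = d *s t" for d t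
  proof -
    have "PU *v (M *v t) = d *s (PU *v t)" "PY *v (M *v t) = d *s (PY *v t)" "PW *v (M *v t) = d *s (PW *v t)"
      unfolding that by (simp_all add: vec.scale)
    then show "a *s (PU *v t) = d *s (PU *v t)" "b *s (PY *v t) = d *s (PY *v t)"
      "c *s (PW *v t) = d *s (PW *v t)"
      unfolding M by (simp_all add: matrix_vector_mul_assoc matrix_add_ldistrib proj_mult)
  qed
  have M_on: "z \<in> U \<Longrightarrow> M *v z = a *s z" "z \<in> Y \<Longrightarrow> M *v z = b *s z" "z \<in> W \<Longrightarrow> M *v z = c *s z"
    by (simp_all add: M matrix_vector_mult_add_rdistrib proj_on)
  show "N *v z \<in> U" if "z \<in> U"
  proof -
    note s = split[OF eig[OF M_on(1)[OF that]]]
    have "PY *v (N *v z) = 0" "PW *v (N *v z) = 0" using s(2,3) ne by auto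
    then have "N *v z = PU *v (N *v z)" using proj_split[of "N *v z"] by simp
    then show ?thesis by (metis proj_in(1))
  qed
  show "N *v z \<in> Y" if "z \<in> Y"
  proof -
    note s = split[OF eig[OF M_on(2)[OF that]]]
    have "PU *v (N *v z) = 0" "PW *v (N *v z) = 0" using s(1,3) ne by auto
    then have "N *v z = PY *v (N *v z)" using proj_split[of "N *v z"] by simp
    then show ?thesis by (metis proj_in(2))
  qed
  show "N *v z \<in> W" if "z \<in> W"
  proof -
    note s = split[OF eig[OF M_on(3)[OF that]]]
    have "PU *v (N *v z) = 0" "PY *v (N *v z) = 0" using s(1,2) ne by auto
    then have "N *v z = PW *v (N *v z)" using proj_split[of "N *v z"] by simp
    then show ?thesis by (metis proj_in(3))
  qed
qed

lemma projection_onto_middle: "projection_onto Y {u + w | u w. u \<in> U \<and> w \<in> W} = PY"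
proof -
  have "(THE y. y \<in> Y \<and> z - y \<in> {u + w | u w. u \<in> U \<and> w \<in> W}) = PY *v z" for z
  proof (rule the_equality)
    have "z - PY *v z = PU *v z + PW *v z" using proj_split[of z] by (simp add: algebra_simps)
    then show "PY *v z \<in> Y \<and> z - PY *v z \<in> {u + w | u w. u \<in> U \<and> w \<in> W}" using proj_in by blast
  next
    fix y assume "y \<in> Y \<and> z - y \<in> {u + w | u w. u \<in> U \<and> w \<in> W}"
    then obtain u w where *: "y \<in> Y" "u \<in> U" "w \<in> W" "z - y = u + w" by auto
    then have "z = u + y + w" by (simp add: algebra_simps)
    then show "y = PY *v z" using * by (simp add: matrix_vector_right_distrib proj_on)
  qed
  then show ?thesis by (simp add: projection_onto_def)
qed

end


section \<open>Exponentials\<close>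

lemma map_fps_const_mult: "map_matrix fps_const (A ** B) = map_matrix fps_const A ** map_matrix fps_const (B :: complex^'k^'k)"
proof -
  have "fps_const (\<Sum>i\<in>I. f i) = (\<Sum>i\<in>I. fps_const (f i :: complex))" for f :: "'k \<Rightarrow> complex" and I
    by (induction I rule: infinite_finite_induct) (simp_all flip: fps_const_add)
  then show ?thesis by (simp add: vec_eq_iff matrix_matrix_mult_def)
qed

lemma map_fps_const_add: "map_matrix fps_const (A + B) = map_matrix fps_const A + map_matrix fps_const (B :: complex^'k^'k)"
  by (simp add: vec_eq_iff)

lemma map_fps_const_mat_1: "map_matrix fps_const (mat 1 :: complex^'k^'k) = mat 1"
  by (simp add: vec_eq_iff mat_def)

lemma map_fps_const_flip: "map_matrix fps_const (flip_matrix :: complex^('n::finite \<times> 'n)^('n \<times> 'n)) = flip_matrix"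
  by (simp add: vec_eq_iff flip_matrix_def)

lemma matrix_pow_scale_map:
  "matrix_pow (f *\<^sub>m map_matrix fps_const (M :: complex^'k^'k)) n = (f ^ n) *\<^sub>m map_matrix fps_const (matrix_pow M n)"
  by (induction n) (simp_all add: matrix_pow_def map_fps_const_mat_1 map_fps_const_mult mult.commute)

text \<open>The series e^(c X^2). Its value at c = -1/(72h) gives q, and the addition law turns all
  crossing eigenvalues into powers of q up to sign.\<close>

definition exp_sq :: "complex \<Rightarrow> complex fps" where
  "exp_sq c = fps_compose (fps_exp c) (fps_X\<^sup>2)"

lemma exp_sq_add: "exp_sq (a + b) = exp_sq a * exp_sq b"
  by (simp add: exp_sq_def fps_exp_add_mult fps_compose_mult_distrib)

lemma exp_sq_0: "exp_sq 0 = 1"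
  by (simp add: exp_sq_def)

lemma exp_sq_power: "exp_sq (of_nat n * c) = exp_sq c ^ n"
  by (induction n) (simp_all add: exp_sq_0 exp_sq_add distrib_right)

lemma (in spectral3) fps_matrix_exp_theta:
  assumes \<Omega>: "\<Omega> = a *\<^sub>m PU + b *\<^sub>m PY + c *\<^sub>m PW"
  shows "fps_matrix_exp (fps_const s *\<^sub>m theta_chord h \<Omega>) =
    exp_sq (s * a / h) *\<^sub>m map_matrix fps_const PU + exp_sq (s * b / h) *\<^sub>m map_matrix fps_const PY
    + exp_sq (s * c / h) *\<^sub>m map_matrix fps_const PW"
proof -
  let ?f = "fps_const (s / h) * fps_X\<^sup>2 :: complex fps"
  have A: "fps_const s *\<^sub>m theta_chord h \<Omega> = ?f *\<^sub>m map_matrix fps_const \<Omega>"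
    by (simp add: theta_chord_def flip: mult.assoc)
  \<comment> \<open>Composition of power series cuts the sum off at k \<le> d, exactly as
    \<open>fps_matrix_exp\<close> does, so coefficients can be compared term by term.\<close>
  have nth: "fps_nth (exp_sq e) d = (\<Sum>k\<le>d. e ^ k * fps_nth ((fps_X\<^sup>2) ^ k) d / fact k)" for e d
    by (simp add: exp_sq_def fps_compose_def atLeast0AtMost)
  have pow: "fps_nth (matrix_pow (fps_const s *\<^sub>m theta_chord h \<Omega>) k $ i $ j) d =
      (s / h) ^ k * fps_nth ((fps_X\<^sup>2) ^ k) d * (a ^ k * PU $ i $ j + b ^ k * PY $ i $ j + c ^ k * PW $ i $ j)"
    for k i j d
    unfolding A matrix_pow_scale_map unfolding \<Omega> spectral_pow
    by (simp add: power_mult_distrib fps_const_power mult.assoc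
        del: fps_const_mult fps_const_add fps_const_divide)
  have "fps_nth (fps_matrix_exp (fps_const s *\<^sub>m theta_chord h \<Omega>) $ i $ j) d =
      PU $ i $ j * fps_nth (exp_sq (s * a / h)) d + PY $ i $ j * fps_nth (exp_sq (s * b / h)) d
      + PW $ i $ j * fps_nth (exp_sq (s * c / h)) d" for i j d
    unfolding nth sum_distrib_left sum.distrib[symmetric]
    by (simp add: fps_matrix_exp_def pow)
      (auto intro!: sum.cong simp: field_simps power_mult_distrib power_divide add_divide_distrib)
  then show ?thesis by (simp add: vec_eq_iff fps_eq_iff mult.commute)
qed


section \<open>The skein relation\<close>

text \<open>
  Here \<open>\<epsilon>\<^sub>1, \<epsilon>\<^sub>2, \<epsilon>\<^sub>3\<close> are the signs by which the flip acts on \<open>U\<close>, \<open>V\<^sup>*\<close>, \<open>W\<close> and \<open>u, v, w\<close> the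
  dimensions; the equations are the traces of \<open>\<Omega>\<close>, \<open>\<tau>\<Omega>\<close>, \<open>\<tau>\<close> and the identity.
\<close>

lemma signs_from_traces:
  fixes u v w \<epsilon>1 \<epsilon>2 \<epsilon>3 :: complex
  assumes "\<epsilon>1 = 1 \<or> \<epsilon>1 = - 1" "\<epsilon>2 = 1 \<or> \<epsilon>2 = - 1" "\<epsilon>3 = 1 \<or> \<epsilon>3 = - 1"
    and eqs: "4 * u - 26 * v - 2 * w = 0" "4 * (\<epsilon>1 * u) - 26 * (\<epsilon>2 * v) - 2 * (\<epsilon>3 * w) = 1404"
      "\<epsilon>1 * u + \<epsilon>2 * v + \<epsilon>3 * w = 27" "u + v + w = 729"
  shows "\<epsilon>1 = 1 \<and> \<epsilon>2 = 1 \<and> \<epsilon>3 = - 1 \<and> u = 351 \<and> v = 27 \<and> w = 351"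
proof -
  \<comment> \<open>Real parts make the equations accessible to linear arithmetic; for seven of the
    eight sign patterns they are inconsistent.\<close>
  have Re: "4 * Re u - 26 * Re v - 2 * Re w = 0" "Re u + Re v + Re w = 729"
    using eqs(1,4)[THEN arg_cong[where f = Re]] by simp_all
  have "\<epsilon>1 = 1 \<and> \<epsilon>2 = 1 \<and> \<epsilon>3 = - 1"
    using assms(1-3) Re eqs(2,3)[THEN arg_cong[where f = Re]] by (elim disjE; simp; linarith?)
  moreover from this have "v = 27" using eqs by simp algebra
  ultimately show ?thesis using eqs by simp
qed

context e6_killing
begin

lemma tensor_square_spectral:
  fixes \<rho> :: "complex^'m \<Rightarrow> complex^'n^'n" and U Vd W :: "(complex^('n \<times> 'n)) set"
  assumes card: "CARD('n) = 27" and rep: "lie_representation br \<rho>"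
    and irrep: "irrep_highest_weight E H \<rho> UNIV [0, 0, 0, 0, 0, 1]"
    and dec: "tensor_square_decomposition E H \<rho> U Vd W"
  obtains PU PY PW where "spectral3 U Vd W PU PY PW"
    "omega_tensor \<rho> x y = (1 / 18) *\<^sub>m PU + (- 13 / 36) *\<^sub>m PY + (- 1 / 36) *\<^sub>m PW"
    "flip_matrix = 1 *\<^sub>m PU + 1 *\<^sub>m PY + (- 1) *\<^sub>m PW"
proof -
  note rep2 = lie_representation_tensor_square[OF rep]
  have dir: "direct_sum3 U Vd W"
    and irU: "irrep_highest_weight E H (tensor_square \<rho>) U [0, 0, 0, 0, 0, 2]"
    and irY: "irrep_highest_weight E H (tensor_square \<rho>) Vd [1, 0, 0, 0, 0, 0]"
    and irW: "irrep_highest_weight E H (tensor_square \<rho>) W [0, 0, 0, 0, 1, 0]"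
    using dec by (simp_all add: tensor_square_decomposition_def)
  have irreducible: "irreducible_subrep (tensor_square \<rho>) U" "irreducible_subrep (tensor_square \<rho>) Vd"
    "irreducible_subrep (tensor_square \<rho>) W"
    using irU irY irW by (simp_all add: irrep_highest_weight_def)
  have "vec.subspace U" "vec.subspace Vd" "vec.subspace W"
    using irreducible by (simp_all add: irreducible_subrep_def subrepresentation_def)
  then obtain PU PY PW where "spectral3 U Vd W PU PY PW"
    by (rule direct_sum3_projections[OF _ _ _ dir])
  then interpret spectral3 U Vd W PU PY PW .
  let ?\<Omega> = "omega_tensor \<rho> x y"
  \<comment> \<open>The coefficient vectors \<open>c\<close> below are the columns of the inverse Cartan matrix.\<close>
  have "(\<Sum>j\<in>{1..6}. of_int (cartan_e6 i j) * ([0, 2, 3, 4, 6, 5, 4] ! j / 3))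
      = (of_nat ([0, 0, 0, 0, 0, 1] ! (i - 1)) :: complex)" if "i \<in> {1..6}" for i
    using that by (auto simp: interval_1_6 cartan_e6_simps nth_Cons')
  from casimir_irreducible[OF rep irrep UNIV_I this]
  \<comment> \<open>52/3 = 4/3 + 2 * 8: the sixth diagonal entry of the inverse Cartan matrix plus
    twice the sixth coefficient of the height element.\<close>
  have "casimir \<rho> *v w = (52 / (3 * killing_scale)) *s w" for w
    by (simp add: interval_1_6 nth_Cons')
  then have c: "casimir \<rho> = (52 / (3 * killing_scale)) *\<^sub>m mat 1" by (simp add: matrix_eq)
  note casimir2 = casimir_tensor_square[OF rep c]
  have omega: "?\<Omega> *v w = ((d - 2 * (52 / (3 * killing_scale))) / 2) *s w"
    if "casimir (tensor_square \<rho>) *v w = d *s w" for w d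
    using that unfolding casimir2
    by (simp add: matrix_vector_mult_add_rdistrib vec_eq_iff field_simps)
  \<comment> \<open>The leading 0 in these lists is padding, since simple roots are numbered from 1.
    Here the column used for V is doubled.\<close>
  have "(\<Sum>j\<in>{1..6}. of_int (cartan_e6 i j) * ([0, 4, 6, 8, 12, 10, 8] ! j / 3))
      = (of_nat ([0, 0, 0, 0, 0, 2] ! (i - 1)) :: complex)" if "i \<in> {1..6}" for i
    using that by (auto simp: interval_1_6 cartan_e6_simps nth_Cons')
  from casimir_irreducible[OF rep2 irU _ this]
  have cas_U: "casimir (tensor_square \<rho>) *v w = (112 / (3 * killing_scale)) *s w" if "w \<in> U" for w
    using that by (simp add: interval_1_6 nth_Cons')
  have "(\<Sum>j\<in>{1..6}. of_int (cartan_e6 i j) * ([0, 4, 3, 5, 6, 4, 2] ! j / 3))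
      = (of_nat ([1, 0, 0, 0, 0, 0] ! (i - 1)) :: complex)" if "i \<in> {1..6}" for i
    using that by (auto simp: interval_1_6 cartan_e6_simps nth_Cons')
  from casimir_irreducible[OF rep2 irY _ this]
  have cas_Y: "casimir (tensor_square \<rho>) *v w = (52 / (3 * killing_scale)) *s w" if "w \<in> Vd" for w
    using that by (simp add: interval_1_6 nth_Cons')
  have "(\<Sum>j\<in>{1..6}. of_int (cartan_e6 i j) * ([0, 4, 6, 8, 12, 10, 5] ! j / 3))
      = (of_nat ([0, 0, 0, 0, 1, 0] ! (i - 1)) :: complex)" if "i \<in> {1..6}" for i
    using that by (auto simp: interval_1_6 cartan_e6_simps nth_Cons')
  from casimir_irreducible[OF rep2 irW _ this]
  have cas_W: "casimir (tensor_square \<rho>) *v w = (100 / (3 * killing_scale)) *s w" if "w \<in> W" for w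
    using that by (simp add: interval_1_6 nth_Cons')
  have Omega: "?\<Omega> = (4 / (3 * killing_scale)) *\<^sub>m PU + (- 26 / (3 * killing_scale)) *\<^sub>m PY + (- 2 / (3 * killing_scale)) *\<^sub>m PW"
    using omega[OF cas_U] omega[OF cas_Y] omega[OF cas_W]
    by (intro matrix_eq_spectral) (simp_all add: field_simps)
  \<comment> \<open>Distinct eigenvalues force the flip, which commutes with \<Omega>, to preserve
    each summand.\<close>
  have "4 / (3 * killing_scale) \<noteq> - 26 / (3 * killing_scale)" "4 / (3 * killing_scale) \<noteq> - 2 / (3 * killing_scale)" "- 26 / (3 * killing_scale) \<noteq> - 2 / (3 * killing_scale)"
    using killing_scale_nonzero by (simp_all add: field_simps)
  note stable = eigenspaces_stable[OF Omega this flip_omega_tensor[OF rep c]]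
  obtain e1 where e1: "e1 = 1 \<or> e1 = - 1" "\<And>w. w \<in> U \<Longrightarrow> flip_matrix *v w = e1 *s w"
    using involution_irreducible[OF irreducible(1) flip_flip flip_tensor_square stable(1)] by blast
  obtain e2 where e2: "e2 = 1 \<or> e2 = - 1" "\<And>w. w \<in> Vd \<Longrightarrow> flip_matrix *v w = e2 *s w"
    using involution_irreducible[OF irreducible(2) flip_flip flip_tensor_square stable(2)] by blast
  obtain e3 where e3: "e3 = 1 \<or> e3 = - 1" "\<And>w. w \<in> W \<Longrightarrow> flip_matrix *v w = e3 *s w"
    using involution_irreducible[OF irreducible(3) flip_flip flip_tensor_square stable(3)] by blast
  have flip: "flip_matrix = e1 *\<^sub>m PU + e2 *\<^sub>m PY + e3 *\<^sub>m PW"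
    by (rule matrix_eq_spectral[OF e1(2) e2(2) e3(2)])
  define u v w where "u = trace PU" and "v = trace PY" and "w = trace PW"
  have tr: "trace (a *\<^sub>m PU + b *\<^sub>m PY + c *\<^sub>m PW) = a * u + b * v + c * w" for a b c
    by (simp add: trace_add u_def v_def w_def)
  have 1: "4 * u - 26 * v - 2 * w = 0"
    using trace_omega[OF rep c] killing_scale_nonzero unfolding Omega tr by (simp add: field_simps) algebra
  \<comment> \<open>1404 = 27 * 52 is the trace 27 c multiplied by 3k.\<close>
  have 2: "4 * (e1 * u) - 26 * (e2 * v) - 2 * (e3 * w) = 1404"
    using trace_flip_omega[OF rep c] killing_scale_nonzero unfolding Omega flip spectral_mult tr card
    by (simp add: field_simps) algebra
  have "trace (flip_matrix :: complex^('n \<times> 'n)^('n \<times> 'n)) = of_nat CARD('n)"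
    using trace_flip_kron[of "mat 1 :: complex^'n^'n" "mat 1"] by (simp add: trace_I)
  then have 3: "e1 * u + e2 * v + e3 * w = 27" unfolding flip tr card by simp
  have "trace (1 *\<^sub>m PU + 1 *\<^sub>m PY + 1 *\<^sub>m PW) = of_nat CARD('n \<times> 'n)"
    by (simp add: proj_sum trace_I)
  then have 4: "u + v + w = 729" unfolding tr by (simp add: card)
  have signs: "e1 = 1" "e2 = 1" "e3 = - 1" "u = 351" "v = 27" "w = 351"
    using signs_from_traces[OF e1(1) e2(1) e3(1) 1 2 3 4] by auto
  \<comment> \<open>With the signs and dimensions inserted, the trace identity reads 2496/k^2 =
    8112/k^2 - 234/k; the linear term comes from the absolute 1/2.\<close>
  have "killing_scale = 24"
    using trace_flip_omega_omega[OF rep c] killing_scale_nonzero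
    unfolding Omega flip spectral_mult tr card signs
    by (simp add: field_simps)
  then show ?thesis
    using that[OF \<open>spectral3 U Vd W PU PY PW\<close>] Omega flip signs by simp
qed

end

text \<open>\<open>a\<close>, \<open>b\<close>, \<open>c\<close> stand for corresponding entries of
  the projections onto U, V*, W, and \<open>R\<close> for r. On U and W the coefficients \<alpha>
  and \<beta> alone satisfy the relation; \<gamma> accounts for the discrepancy left on V*.\<close>

lemma skein_coefficients:
  fixes q R a b c :: "complex fls"
  assumes "q \<noteq> 0" "R \<noteq> 0"
  shows "q ^ 2 * a + inverse (q ^ 13) * b - inverse q * c
    = q * (inverse (q ^ 2) * a + q ^ 13 * b - q * c) + (q ^ 3 - 1) / q * (a + b + c)
      - (q ^ 27 + q ^ 15 - q ^ 12 - 1) / (R * q ^ 13) * (R * b)"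
proof -
  have 1: "q ^ 2 = q * inverse (q ^ 2) + (q ^ 3 - 1) / q"
    using assms by (simp add: field_simps power2_eq_square power3_eq_cube)
  have 2: "inverse (q ^ 13) = q * q ^ 13 + (q ^ 3 - 1) / q
      - (q ^ 27 + q ^ 15 - q ^ 12 - 1) / (R * q ^ 13) * R"
    using assms by (simp add: divide_simps) (simp add: algebra_simps flip: power_add power_Suc)
  have 3: "- inverse q = - (q * q) + (q ^ 3 - 1) / q"
    using assms by (simp add: field_simps power3_eq_cube)
  \<comment> \<open>Replacing powers of q by independent variables leaves an identity linear in
    \<open>a\<close>, \<open>b\<close>, \<open>c\<close>.\<close>
  have combine: "q2 * a + i13 * b - i1 * c = q * (i2 * a + q13 * b - q * c) + s * (a + b + c) - K * (R * b)"
    if "q2 = q * i2 + s" "i13 = q * q13 + s - K * R" "- i1 = - (q * q) + s" for q2 i13 i1 i2 q13 s K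
  proof -
    have "i1 = q * q - s" using that(3) by (simp add: algebra_simps minus_equation_iff)
    then show ?thesis unfolding that(1,2) by (simp only:) (simp add: algebra_simps)
  qed
  show ?thesis by (rule combine[OF 1 2 3])
qed

theorem mainTheorem3:
  fixes br :: "complex^'m \<Rightarrow> complex^'m \<Rightarrow> complex^'m"
    and E F H :: "nat \<Rightarrow> complex^'m"
    and x y :: "'m \<Rightarrow> complex^'m"
    and \<rho> :: "complex^'m \<Rightarrow> complex^'n^'n"
    and U Vd W :: "(complex^('n \<times> 'n)) set"
    and h :: complex
    and r :: "complex fps"
  assumes "e6_chevalley br E F H"
    and "dual_bases (killing_form br) x y"
    and "CARD('n) = 27"
    and "lie_representation br \<rho>"
    and "irrep_highest_weight E H \<rho> UNIV [0, 0, 0, 0, 0, 1]"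
    and "tensor_square_decomposition E H \<rho> U Vd W"
    and "h \<noteq> 0"
    and "r \<noteq> 0"
  shows "let I = invariant h (omega_tensor \<rho> x y)
                   (projection_onto Vd {u + w | u w. u \<in> U \<and> w \<in> W}) r;
             q = q_param h;
             \<alpha> = q;
             \<beta> = (q ^ 3 - 1) / q;
             \<gamma> = - ((q ^ 27 + q ^ 15 - q ^ 12 - 1) / (fps_to_fls r * q ^ 13))
         in I X_pos = \<alpha> *\<^sub>m I X_neg + \<beta> *\<^sub>m I Id_strands + \<gamma> *\<^sub>m I H_tangle"
proof -
  interpret e6_killing br x y E F H
    using assms(1,2) by unfold_locales (simp_all add: e6_chevalley_def simple_lie_algebra_def)
  obtain PU PY PW where spec: "spectral3 U Vd W PU PY PW"
    and Omega: "omega_tensor \<rho> x y = (1 / 18) *\<^sub>m PU + (- 13 / 36) *\<^sub>m PY + (- 1 / 36) *\<^sub>m PW"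
    and flip: "flip_matrix = 1 *\<^sub>m PU + 1 *\<^sub>m PY + (- 1) *\<^sub>m PW"
    using tensor_square_spectral[OF assms(3-6)] .
  interpret spectral3 U Vd W PU PY PW by (fact spec)
  define t where "t = - 1 / (72 * h)"
  define q where "q = fps_to_fls (exp_sq t)"
  have q: "q_param h = q" by (simp add: q_param_def q_def exp_sq_def t_def)
  have pos: "fps_to_fls (exp_sq (of_nat n * t)) = q ^ n" for n
    by (simp add: exp_sq_power q_def fps_to_fls_power)
  have "q * fps_to_fls (exp_sq (- t)) = 1"
    using exp_sq_add[of t "- t"] by (simp add: q_def exp_sq_0 flip: fls_times_fps_to_fls)
  then have q0: "q \<noteq> 0" by auto
  have neg: "fps_to_fls (exp_sq (- (of_nat n * t))) = inverse (q ^ n)" for n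
  proof -
    have "q ^ n * fps_to_fls (exp_sq (- (of_nat n * t))) = 1"
      using exp_sq_add[of "of_nat n * t" "- (of_nat n * t)"]
      by (simp add: exp_sq_0 flip: pos fls_times_fps_to_fls)
    then show ?thesis by (metis inverse_unique)
  qed
  have G: "fps_to_fls (exp_sq (2 * t)) = q ^ 2" "fps_to_fls (exp_sq (- (13 * t))) = inverse (q ^ 13)"
    "fps_to_fls (exp_sq (- t)) = inverse q" "fps_to_fls (exp_sq (- (2 * t))) = inverse (q ^ 2)"
    "fps_to_fls (exp_sq (13 * t)) = q ^ 13" "fps_to_fls (exp_sq t) = q"
    using pos[of 2] neg[of 13] neg[of 1] neg[of 2] pos[of 13] by (simp_all add: q_def)
  let ?m = "map_matrix fps_const"
  have flip_mult: "flip_matrix ** (a *\<^sub>m ?m PU + b *\<^sub>m ?m PY + c *\<^sub>m ?m PW) = a *\<^sub>m ?m PU + b *\<^sub>m ?m PY - c *\<^sub>m ?m PW"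
    for a b c
  proof -
    have "flip_matrix ** PU = PU" "flip_matrix ** PY = PY" "flip_matrix ** PW = (- 1) *\<^sub>m PW"
      unfolding flip by (simp_all add: matrix_add_rdistrib' matrix_sub_rdistrib proj_mult vec_eq_iff)
    then have "flip_matrix ** ?m PU = ?m PU" "flip_matrix ** ?m PY = ?m PY" "flip_matrix ** ?m PW = - ?m PW"
      unfolding map_fps_const_flip[symmetric] map_fps_const_mult[symmetric] by (simp_all add: vec_eq_iff)
    then show ?thesis by (simp add: matrix_add_ldistrib)
  qed
  \<comment> \<open>Multiplying the eigenvalues 1/18, -13/36, -1/36 by -1/(2h) gives 2t, -13t, -t;
    the minus sign before the last term is the sign of the flip on W.\<close>
  have Xp: "invariant_fps h (omega_tensor \<rho> x y) PY r X_pos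
      = exp_sq (2 * t) *\<^sub>m ?m PU + exp_sq (- (13 * t)) *\<^sub>m ?m PY - exp_sq (- t) *\<^sub>m ?m PW"
    unfolding invariant_fps.simps fps_matrix_exp_theta[OF Omega] flip_mult by (simp add: t_def field_simps)
  have Xn: "invariant_fps h (omega_tensor \<rho> x y) PY r X_neg
      = exp_sq (- (2 * t)) *\<^sub>m ?m PU + exp_sq (13 * t) *\<^sub>m ?m PY - exp_sq t *\<^sub>m ?m PW"
    unfolding invariant_fps.simps fps_matrix_exp_theta[OF Omega] flip_mult by (simp add: t_def field_simps)
  have Id: "invariant_fps h (omega_tensor \<rho> x y) PY r Id_strands = ?m PU + ?m PY + ?m PW"
    by (simp add: map_fps_const_mat_1 proj_sum flip: map_fps_const_add)
  have R0: "fps_to_fls r \<noteq> 0" using assms(8) by simp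
  show ?thesis
    unfolding Let_def q projection_onto_middle invariant_def Xp Xn Id invariant_fps.simps(4)
    by (simp add: vec_eq_iff G skein_coefficients[OF q0 R0] fls_times_fps_to_fls del: fps_const_add)
qed

end
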